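(* Let $a>0$ and $\Omega=(0,a)\times(0,a)\subset\mathbb{R}^2$. There is a constant $C_\Omega>0$ depending only on $\Omega$ such that the following holds. Let $m\ge 2$, let $f_1,\dots,f_m$ be admissible internal dynamics and $\phi_1,\dots,\phi_m$ admissible boundary data (as defined in the context), and assume that each $f_l(z,s)$ is nondecreasing with respect to the variable $s$. Let $(u_1,\dots,u_m)\in S$ be an exact minimizer of $E$ over $S$, and suppose that $(u_1,\dots,u_m)\in S\cap (C^2(\Omega))^m$. Let $N$ be a positive integer, $h=a/N$, and let $(u_h^1,\dots,u_h^m)$ be a solution of the discrete system (finite difference scheme) on the mesh $\Omega_h$. Then for every $l\in\{1,\dots,m\}$, $$\|u_l-u_h^l\|_{L^\infty(\Omega_h)}\le C_\Omega\cdot\sum_{k=1}^{m}\|L_hu_k-\Delta u_k\|_{L^\infty(\Omega)} .$$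
   Context: Setting. $\Omega=(0,a)\times(0,a)$, $m\ge2$ is an integer. Admissible internal dynamics: for each $i$, $f_i:\Omega\times[0,\infty)\to\mathbb{R}$ is Lipschitz continuous in $s$, uniformly continuous in $x$, and $f_i(x,0)\equiv 0$; $f_i$ is extended to $s\le 0$ by $f_i(x,s)=-f_i(x,-s)$. Alternatively, the case where the dynamics do not depend on $s$, $f_i(x,s)=f_i(x)$, is also allowed; in that case the assumption is instead that for all $i$ the function $f_i$ is nonnegative and uniformly continuous in $x$. Set $F_i(x,s)=\int_0^s f_i(x,v)\,dv$ for $s\ge 0$ (extended evenly in $s$). Admissible boundary data: $\phi_i\in H^{1/2}(\partial\Omega)$, $\phi_i\ge 0$, $\phi_i\cdot\phi_j=0$ on $\partial\Omega$ for $i\ne j$; each $\phi_i$ is extended by zero outside $\partial\Omega$. Functional and constraint set: $$E(u_1,\dots,u_m)=\int_\Omega\sum_{i=1}^m\Big(\tfrac12|\nabla u_i|^2+F_i(x,u_i)\Big)dx,$$ $$S=\{(u_1,\dots,u_m)\in (W^{1,2}(\Omega))^m:\ u_i\ge 0,\ u_i\cdot u_j=0 \text{ a.e. in } \Omega \text{ for } i\neq j,\ u_i=\phi_i \text{ on }\partial\Omega\}.$$ Mesh: $h=a/N$, $\Omega_h=\{(ih,jh):0\le i,j\le N\}$, $\Omega_h^o=\{(ih,jh):1\le i,j\le N-1\}$, $\partial\Omega_h=\Omega_h\setminus\Omega_h^o$. Discrete Laplacian: for $(x,y)\in\Omega$, $L_hv(x,y)=h^{-2}\big[v(x-h,y)+v(x+h,y)+v(x,y-h)+v(x,y+h)-4v(x,y)\big]$.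 Discrete system (finite difference scheme): functions $u_h^1,\dots,u_h^m:\Omega_h\to\mathbb{R}$ with, for every $l=1,\dots,m$, $$u_h^l(z)=\max\Big(-\tfrac{h^2}{4}f_l(z,u_h^l(z))+\overline u_h^l(z)-\sum_{p\ne l}\overline u_h^p(z),\,0\Big)\ \ (z\in\Omega_h^o),\qquad u_h^l(z)=\phi_l(z)\ \ (z\in\partial\Omega_h),$$ where $\overline u_h^l(z)$ is the average of $u_h^l$ over the four nearest mesh neighbours of $z$. Norms: $\|v\|_{L^\infty(\Omega_h)}=\max_{z\in\Omega_h}|v(z)|$, and $\|\cdot\|_{L^\infty(\Omega)}$ is the $L^\infty$ norm over $\Omega$. *)

theory Defs
  imports "HOL-Analysis.Analysis"
begin

section \<open>Classical derivatives\<close>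

definition partial :: "'a::euclidean_space \<Rightarrow> ('a \<Rightarrow> real) \<Rightarrow> 'a \<Rightarrow> real" where
  "partial b v x = frechet_derivative v (at x) b"

definition gradient :: "('a::euclidean_space \<Rightarrow> real) \<Rightarrow> 'a \<Rightarrow> 'a" where
  "gradient v x = (\<Sum>b\<in>Basis. partial b v x *\<^sub>R b)"

definition laplacian :: "('a::euclidean_space \<Rightarrow> real) \<Rightarrow> 'a \<Rightarrow> real" where
  "laplacian v x = (\<Sum>b\<in>Basis. partial b (partial b v) x)"

text \<open>\<open>Ck k S v\<close>: the class \<open>C\<^sup>k(S)\<close>, intended for open \<open>S\<close>.\<close>

fun Ck :: "nat \<Rightarrow> 'a::euclidean_space set \<Rightarrow> ('a \<Rightarrow> real) \<Rightarrow> bool" where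
  "Ck 0 S v \<longleftrightarrow> continuous_on S v"
| "Ck (Suc k) S v \<longleftrightarrow>
     (\<forall>x\<in>S. v differentiable (at x)) \<and> (\<forall>b\<in>Basis. Ck k S (partial b v))"

definition smooth :: "('a::euclidean_space \<Rightarrow> real) \<Rightarrow> bool" where
  "smooth v \<longleftrightarrow> (\<forall>k. Ck k UNIV v)"

definition test_function :: "'a::euclidean_space set \<Rightarrow> ('a \<Rightarrow> real) \<Rightarrow> bool" where
  "test_function S \<psi> \<longleftrightarrow>
     smooth \<psi> \<and> compact (closure {x. \<psi> x \<noteq> 0}) \<and> closure {x. \<psi> x \<noteq> 0} \<subseteq> S"


section \<open>The Sobolev space \<open>W\<^sup>1\<^sup>,\<^sup>2\<close>\<close>

definition L2_on :: "'a::euclidean_space set \<Rightarrow> ('a \<Rightarrow> 'b::euclidean_space) \<Rightarrow> bool" where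
  "L2_on S u \<longleftrightarrow>
     set_borel_measurable lebesgue S u \<and> set_integrable lebesgue S (\<lambda>x. (norm (u x))\<^sup>2)"

definition locally_integrable_on ::
    "'a::euclidean_space set \<Rightarrow> ('a \<Rightarrow> 'b::euclidean_space) \<Rightarrow> bool" where
  "locally_integrable_on S u \<longleftrightarrow>
     (\<forall>K. compact K \<and> K \<subseteq> S \<longrightarrow> set_integrable lebesgue K u)"

definition has_weak_gradient ::
    "'a::euclidean_space set \<Rightarrow> ('a \<Rightarrow> real) \<Rightarrow> ('a \<Rightarrow> 'a) \<Rightarrow> bool" where
  "has_weak_gradient S u g \<longleftrightarrow>
     locally_integrable_on S u \<and> locally_integrable_on S g \<and>
     (\<forall>\<psi>. test_function S \<psi> \<longrightarrow> (\<forall>b\<in>Basis.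
        (LINT x:S|lebesgue. u x * partial b \<psi> x) = - (LINT x:S|lebesgue. (g x \<bullet> b) * \<psi> x)))"

definition W12 :: "'a::euclidean_space set \<Rightarrow> ('a \<Rightarrow> real) set" where
  "W12 S = {u. L2_on S u \<and> (\<exists>g. has_weak_gradient S u g \<and> L2_on S g)}"

text \<open>A weak gradient on an open set is unique up to a null set, so the choice below is
  immaterial under an integral.\<close>

definition weak_gradient :: "'a::euclidean_space set \<Rightarrow> ('a \<Rightarrow> real) \<Rightarrow> 'a \<Rightarrow> 'a" where
  "weak_gradient S u = (SOME g. has_weak_gradient S u g)"


section \<open>The square, its boundary, traces\<close>

definition square :: "real \<Rightarrow> (real \<times> real) set" where
  "square a = {0<..<a} \<times> {0<..<a}"

text \<open>Arclength parametrisation of the boundary of the square by \<open>[0, 4a]\<close>,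
  counterclockwise from the origin; it carries Lebesgue measure to the surface measure.\<close>

definition bdry :: "real \<Rightarrow> real \<Rightarrow> real \<times> real" where
  "bdry a t =
     (if t \<le> a then (t, 0)
      else if t \<le> 2 * a then (a, t - a)
      else if t \<le> 3 * a then (3 * a - t, a)
      else (0, 4 * a - t))"

text \<open>\<open>H\<^sup>1\<^sup>/\<^sup>2\<close> of the one-dimensional boundary: square integrable functions with finite
  Gagliardo seminorm, whose kernel exponent is \<open>1 + 2 * (1/2) = 2\<close>.\<close>

definition H_half_bdry :: "real \<Rightarrow> (real \<times> real \<Rightarrow> real) set" where
  "H_half_bdry a = {\<phi>. L2_on {0..4 * a} (\<lambda>t. \<phi> (bdry a t)) \<and>
     set_integrable lebesgue ({0..4 * a} \<times> {0..4 * a})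
       (\<lambda>(s, t). (\<phi> (bdry a s) - \<phi> (bdry a t))\<^sup>2 / (dist (bdry a s) (bdry a t))\<^sup>2)}"

text \<open>The trace operator is the continuous extension to \<open>W\<^sup>1\<^sup>,\<^sup>2\<close>
  of the restriction of smooth functions to the boundary.\<close>

definition has_trace :: "real \<Rightarrow> (real \<times> real \<Rightarrow> real) \<Rightarrow> (real \<times> real \<Rightarrow> real) \<Rightarrow> bool" where
  "has_trace a u \<phi> \<longleftrightarrow>
     u \<in> W12 (square a) \<and> L2_on {0..4 * a} (\<lambda>t. \<phi> (bdry a t)) \<and>
     (\<exists>w :: nat \<Rightarrow> real \<times> real \<Rightarrow> real.
        (\<forall>n. smooth (w n)) \<and>
        (\<lambda>n. LINT x:square a|lebesgue. (w n x - u x)\<^sup>2) \<longlonglongrightarrow> 0 \<and>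
        (\<lambda>n. LINT x:square a|lebesgue.
               (norm (gradient (w n) x - weak_gradient (square a) u x))\<^sup>2) \<longlonglongrightarrow> 0 \<and>
        (\<lambda>n. LINT t:{0..4 * a}|lebesgue. (w n (bdry a t) - \<phi> (bdry a t))\<^sup>2) \<longlonglongrightarrow> 0)"


section \<open>The segregation problem\<close>

text \<open>Families are indexed by \<open>{1..m}\<close>; other indices are irrelevant.\<close>

definition dynamics_state_dependent :: "real \<Rightarrow> (real \<times> real \<Rightarrow> real \<Rightarrow> real) \<Rightarrow> bool" where
  "dynamics_state_dependent a f \<longleftrightarrow>
     (\<exists>L. \<forall>x\<in>square a. L-lipschitz_on {0..} (f x)) \<and>
     (\<forall>s\<ge>0. uniformly_continuous_on (square a) (\<lambda>x. f x s)) \<and>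
     (\<forall>x\<in>square a. f x 0 = 0) \<and>
     (\<forall>x\<in>square a. \<forall>s\<le>0. f x s = - f x (- s))"

definition dynamics_state_independent :: "real \<Rightarrow> (real \<times> real \<Rightarrow> real \<Rightarrow> real) \<Rightarrow> bool" where
  "dynamics_state_independent a f \<longleftrightarrow>
     (\<exists>g. (\<forall>x\<in>square a. \<forall>s\<ge>0. f x s = g x) \<and>
          (\<forall>x\<in>square a. 0 \<le> g x) \<and> uniformly_continuous_on (square a) g)"

definition admissible_dynamics ::
    "real \<Rightarrow> nat \<Rightarrow> (nat \<Rightarrow> real \<times> real \<Rightarrow> real \<Rightarrow> real) \<Rightarrow> bool" where
  "admissible_dynamics a m f \<longleftrightarrow>
     (\<forall>i\<in>{1..m}. dynamics_state_dependent a (f i)) \<or>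
     (\<forall>i\<in>{1..m}. dynamics_state_independent a (f i))"

definition admissible_boundary ::
    "real \<Rightarrow> nat \<Rightarrow> (nat \<Rightarrow> real \<times> real \<Rightarrow> real) \<Rightarrow> bool" where
  "admissible_boundary a m \<phi> \<longleftrightarrow>
     (\<forall>i\<in>{1..m}. \<phi> i \<in> H_half_bdry a \<and>
        (\<forall>x\<in>frontier (square a). 0 \<le> \<phi> i x) \<and>
        (\<forall>x. x \<notin> frontier (square a) \<longrightarrow> \<phi> i x = 0)) \<and>
     (\<forall>i\<in>{1..m}. \<forall>j\<in>{1..m}. i \<noteq> j \<longrightarrow> (\<forall>x\<in>frontier (square a). \<phi> i x * \<phi> j x = 0))"

definition potential :: "(real \<times> real \<Rightarrow> real \<Rightarrow> real) \<Rightarrow> real \<times> real \<Rightarrow> real \<Rightarrow> real" where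
  "potential f x s = integral {0..\<bar>s\<bar>} (f x)"

definition energy ::
    "real \<Rightarrow> nat \<Rightarrow> (nat \<Rightarrow> real \<times> real \<Rightarrow> real \<Rightarrow> real) \<Rightarrow> (nat \<Rightarrow> real \<times> real \<Rightarrow> real) \<Rightarrow> real" where
  "energy a m f u =
     (LINT x:square a|lebesgue.
        (\<Sum>i=1..m. 1 / 2 * (norm (weak_gradient (square a) (u i) x))\<^sup>2 + potential (f i) x (u i x)))"

text \<open>Elements of \<open>W\<^sup>1\<^sup>,\<^sup>2\<close> are represented by functions. Besides the trace condition, the
  representative is required to equal the boundary datum at every point of the boundary, since
  its values at boundary mesh points are used. The boundary is a null set, so this
  excludes no element of \<open>W\<^sup>1\<^sup>,\<^sup>2\<close> and does not affect the energy.\<close>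

definition admissible_class ::
    "real \<Rightarrow> nat \<Rightarrow> (nat \<Rightarrow> real \<times> real \<Rightarrow> real) \<Rightarrow> (nat \<Rightarrow> real \<times> real \<Rightarrow> real) set" where
  "admissible_class a m \<phi> =
     {u. (\<forall>i\<in>{1..m}. u i \<in> W12 (square a) \<and>
            (AE x in lebesgue. x \<in> square a \<longrightarrow> 0 \<le> u i x) \<and>
            has_trace a (u i) (\<phi> i) \<and>
            (\<forall>x\<in>frontier (square a). u i x = \<phi> i x)) \<and>
         (\<forall>i\<in>{1..m}. \<forall>j\<in>{1..m}. i \<noteq> j \<longrightarrow>
            (AE x in lebesgue. x \<in> square a \<longrightarrow> u i x * u j x = 0))}"

definition energy_minimizer ::
    "real \<Rightarrow> nat \<Rightarrow> (nat \<Rightarrow> real \<times> real \<Rightarrow> real \<Rightarrow> real) \<Rightarrow> (nat \<Rightarrow> real \<times> real \<Rightarrow> real) \<Rightarrow>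
      (nat \<Rightarrow> real \<times> real \<Rightarrow> real) \<Rightarrow> bool" where
  "energy_minimizer a m f \<phi> u \<longleftrightarrow>
     u \<in> admissible_class a m \<phi> \<and>
     (\<forall>w\<in>admissible_class a m \<phi>. energy a m f u \<le> energy a m f w)"


section \<open>The finite difference scheme\<close>

definition mesh :: "real \<Rightarrow> nat \<Rightarrow> (real \<times> real) set" where
  "mesh h N = {(real i * h, real j * h) |i j. i \<le> N \<and> j \<le> N}"

definition mesh_interior :: "real \<Rightarrow> nat \<Rightarrow> (real \<times> real) set" where
  "mesh_interior h N = {(real i * h, real j * h) |i j. i \<in> {1..N - 1} \<and> j \<in> {1..N - 1}}"

definition mesh_boundary :: "real \<Rightarrow> nat \<Rightarrow> (real \<times> real) set" where
  "mesh_boundary h N = mesh h N - mesh_interior h N"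

definition discrete_laplacian :: "real \<Rightarrow> (real \<times> real \<Rightarrow> real) \<Rightarrow> real \<times> real \<Rightarrow> real" where
  "discrete_laplacian h v = (\<lambda>(x, y).
     (v (x - h, y) + v (x + h, y) + v (x, y - h) + v (x, y + h) - 4 * v (x, y)) / h\<^sup>2)"

definition nbr_average :: "real \<Rightarrow> (real \<times> real \<Rightarrow> real) \<Rightarrow> real \<times> real \<Rightarrow> real" where
  "nbr_average h v = (\<lambda>(x, y).
     (v (x - h, y) + v (x + h, y) + v (x, y - h) + v (x, y + h)) / 4)"

definition discrete_solution ::
    "real \<Rightarrow> nat \<Rightarrow> nat \<Rightarrow> (nat \<Rightarrow> real \<times> real \<Rightarrow> real \<Rightarrow> real) \<Rightarrow> (nat \<Rightarrow> real \<times> real \<Rightarrow> real) \<Rightarrow>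
      (nat \<Rightarrow> real \<times> real \<Rightarrow> real) \<Rightarrow> bool" where
  "discrete_solution h N m f \<phi> v \<longleftrightarrow>
     (\<forall>l\<in>{1..m}.
        (\<forall>z\<in>mesh_interior h N.
           v l z = max (- (h\<^sup>2 / 4) * f l z (v l z) + nbr_average h (v l) z
                          - (\<Sum>p\<in>{1..m} - {l}. nbr_average h (v p) z)) 0) \<and>
        (\<forall>z\<in>mesh_boundary h N. v l z = \<phi> l z))"

definition mesh_norm :: "real \<Rightarrow> nat \<Rightarrow> (real \<times> real \<Rightarrow> real) \<Rightarrow> real" where
  "mesh_norm h N v = Max ((\<lambda>z. \<bar>v z\<bar>) ` mesh h N)"

text \<open>The norm is a pointwise supremum, possibly infinite; the functions it is applied to are defined
  pointwise, with values at individual mesh points that matter even where continuity is lacking.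
  A discrete Laplacian at a point near the boundary may refer to values of \<open>v\<close> outside the
  closed square. Statements quantified over all functions \<open>v\<close> on the plane hold for every such
  extension; an extension with vanishing consistency error at all points whose
  stencil leaves the closed square exists, so nothing is gained from those points.\<close>

definition sup_norm_on :: "'a set \<Rightarrow> ('a \<Rightarrow> real) \<Rightarrow> ennreal" where
  "sup_norm_on S v = (SUP z\<in>S. ennreal \<bar>v z\<bar>)"

end

theory Submission
  imports Defs
begin

text \<open>
  The minimizer and the discrete solution satisfy the same nonlinear system of difference
  inequalities, one of them up to the consistency error and the other exactly, and this system
  obeys a comparison principle with a constant that depends on the square alone.

  For a segregated family \<open>w\<close> (nonnegative, at most one component nonzero at each point) put
  \<open>g\<^sub>l = w\<^sub>l - (\<Sum>p\<noteq>l. w\<^sub>p)\<close>. A solution of the scheme is segregated, and solving its equation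
  for the discrete Laplacian gives \<open>L\<^sub>h g\<^sub>l \<le> f\<^sub>l(z, w\<^sub>l)\<close> at every interior mesh point, with
  equality where \<open>w\<^sub>l > 0\<close> (lemma \<open>discrete_solution_is_approx\<close>). The same relation, with
  an error \<open>\<epsilon>\<close> allowed on both sides, is called \<open>approx_discrete_solution\<close>.

  For the minimizer, the variation \<open>u\<^sub>l + t \<psi>\<close> with \<open>\<psi>\<close> supported where \<open>u\<^sub>l > 0\<close>
  keeps the family segregated, so \<open>\<Delta>u\<^sub>l = f\<^sub>l(x, u\<^sub>l)\<close> on that set (lemma
  \<open>euler_lagrange\<close>). A zero of the \<open>C\<^sup>2\<close> function \<open>u\<^sub>l \<ge> 0\<close> is a minimum, so \<open>\<Delta>u\<^sub>l \<ge> 0\<close>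
  there, while continuity of both sides of the Euler--Lagrange equation gives
  \<open>\<Delta>u\<^sub>l \<le> f\<^sub>l(x, 0)\<close>. Together these say that \<open>\<Delta>g\<^sub>l \<le> f\<^sub>l(x, u\<^sub>l)\<close>, with equality where
  \<open>u\<^sub>l > 0\<close>. Exchanging \<open>\<Delta>\<close> for \<open>L\<^sub>h\<close> costs at most the sum of the consistency errors of
  the components (lemma \<open>minimizer_is_approx_discrete_solution\<close>).

  For the comparison of two families \<open>U\<close> and \<open>V\<close>, with functions \<open>g\<^sup>U\<close> and \<open>g\<^sup>V\<close>, one maximizes
  \<open>\<bar>g\<^sup>U\<^sub>l - g\<^sup>V\<^sub>l\<bar> - \<kappa> b\<close> jointly over the component \<open>l\<close> and the mesh point, where \<open>b\<close> is a
  nonnegative barrier with \<open>L\<^sub>h b = -1\<close> and \<open>\<kappa>\<close> exceeds the total error. The maximization over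
  \<open>l\<close> is what makes the argument work: the maximum can be moved to a component in which the family
  with the larger \<open>g\<^sub>l\<close> is strictly positive (lemma \<open>gap_attained_at_positive\<close>). In that
  component monotonicity of \<open>f\<^sub>l\<close> makes \<open>L\<^sub>h\<close> of the maximized difference positive, which
  is impossible at a maximum. Since \<open>b \<le> a\<^sup>2 / 8\<close> on the mesh, the constant is \<open>a\<^sup>2 / 8\<close>.

  The energy is formulated with an arbitrarily chosen weak gradient. Computing its first variation
  therefore rests on the fact that weak gradients are unique up to null sets, which is the
  fundamental lemma of the calculus of variations, proved here with explicit bump functions that
  increase to the indicator of a box.
\<close>


section \<open>The discrete comparison principle\<close>

text \<open>Unlike \<open>w\<^sub>l\<close>, this signed combination does not lose information where \<open>w\<^sub>l\<close> vanishes: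
  for a segregated family it equals minus the component that is positive there. It is the
  quantity whose averages occur in the scheme.\<close>

definition component_gap :: "nat \<Rightarrow> (nat \<Rightarrow> 'a \<Rightarrow> real) \<Rightarrow> nat \<Rightarrow> 'a \<Rightarrow> real" where
  "component_gap m w l z = w l z - (\<Sum>p\<in>{1..m} - {l}. w p z)"

definition segregated_on :: "'a set \<Rightarrow> nat \<Rightarrow> (nat \<Rightarrow> 'a \<Rightarrow> real) \<Rightarrow> bool" where
  "segregated_on A m w \<longleftrightarrow>
     (\<forall>l\<in>{1..m}. \<forall>z\<in>A. 0 \<le> w l z) \<and>
     (\<forall>l\<in>{1..m}. \<forall>p\<in>{1..m}. \<forall>z\<in>A. l \<noteq> p \<longrightarrow> w l z = 0 \<or> w p z = 0)"

text \<open>For \<open>\<epsilon> = 0\<close> the two inequalities are the scheme solved for the discrete Laplacian: an equation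
  where \<open>w\<^sub>l > 0\<close>, and only an upper bound where the maximum with zero is active.\<close>

definition approx_discrete_solution ::
    "real \<Rightarrow> nat \<Rightarrow> nat \<Rightarrow> (nat \<Rightarrow> real \<times> real \<Rightarrow> real \<Rightarrow> real) \<Rightarrow> real \<Rightarrow>
      (nat \<Rightarrow> real \<times> real \<Rightarrow> real) \<Rightarrow> bool" where
  "approx_discrete_solution h N m f \<epsilon> w \<longleftrightarrow>
     segregated_on (mesh h N) m w \<and>
     (\<forall>l\<in>{1..m}. \<forall>z\<in>mesh_interior h N.
        discrete_laplacian h (component_gap m w l) z \<le> f l z (w l z) + \<epsilon> \<and>
        (0 < w l z \<longrightarrow> f l z (w l z) - \<epsilon> \<le> discrete_laplacian h (component_gap m w l) z))"

lemma component_gap_le: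
  assumes "segregated_on A m w" "z \<in> A" "l \<in> {1..m}"
  shows "component_gap m w l z \<le> w l z"
proof -
  have "0 \<le> (\<Sum>p\<in>{1..m} - {l}. w p z)"
    using assms unfolding segregated_on_def by (intro sum_nonneg) auto
  then show ?thesis unfolding component_gap_def by linarith
qed

lemma component_gap_pos:
  assumes "segregated_on A m w" "z \<in> A" "l \<in> {1..m}" "0 < w l z"
  shows "component_gap m w l z = w l z"
proof -
  have "w p z = 0" if "p \<in> {1..m} - {l}" for p
    using assms that unfolding segregated_on_def by (metis DiffD1 DiffD2 insertI1 less_irrefl)
  then have "(\<Sum>p\<in>{1..m} - {l}. w p z) = 0" by (intro sum.neutral) auto
  then show ?thesis unfolding component_gap_def by linarith
qed

lemma component_gap_single:
  assumes "segregated_on A m w" "z \<in> A" "l \<in> {1..m}" "q \<in> {1..m}" "q \<noteq> l" "0 < w q z"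
  shows "component_gap m w l z = - w q z"
proof -
  have 0: "w p z = 0" if "p \<in> {1..m}" "p \<noteq> q" for p
    using assms that unfolding segregated_on_def by (metis less_irrefl)
  have "(\<Sum>p\<in>{1..m} - {l}. w p z) = w q z + (\<Sum>p\<in>{1..m} - {l} - {q}. w p z)"
    using assms by (intro sum.remove) auto
  also have "(\<Sum>p\<in>{1..m} - {l} - {q}. w p z) = 0"
    using 0 by (intro sum.neutral) auto
  finally show ?thesis
    using 0[of l] assms unfolding component_gap_def by simp
qed

lemma component_gap_add_le:
  assumes "\<And>p. p \<in> {1..m} \<Longrightarrow> 0 \<le> w p z" "l \<in> {1..m}" "q \<in> {1..m}" "q \<noteq> l"
  shows "component_gap m w q z \<le> - component_gap m w l z"
proof -
  have "w q z \<le> (\<Sum>p\<in>{1..m} - {l}. w p z)" "w l z \<le> (\<Sum>p\<in>{1..m} - {q}. w p z)"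
    using assms by (intro member_le_sum; auto)+
  then show ?thesis unfolding component_gap_def by linarith
qed

lemma discrete_laplacian_diff:
  "discrete_laplacian h (\<lambda>z. v z - w z) z = discrete_laplacian h v z - discrete_laplacian h w z"
  by (cases z) (simp add: discrete_laplacian_def diff_divide_distrib[symmetric] algebra_simps)

lemma discrete_laplacian_cmult:
  "discrete_laplacian h (\<lambda>z. c * v z) z = c * discrete_laplacian h v z"
  by (cases z) (simp add: discrete_laplacian_def algebra_simps)

lemma discrete_laplacian_sum:
  "finite I \<Longrightarrow> discrete_laplacian h (\<lambda>z. \<Sum>i\<in>I. v i z) z = (\<Sum>i\<in>I. discrete_laplacian h (v i) z)"
  by (cases z) (simp add: discrete_laplacian_def sum.distrib sum_subtractf sum_divide_distrib sum_distrib_left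
      diff_divide_distrib add_divide_distrib)

lemma discrete_laplacian_component_gap:
  "discrete_laplacian h (component_gap m w l) z =
    discrete_laplacian h (w l) z - (\<Sum>p\<in>{1..m} - {l}. discrete_laplacian h (w p) z)"
  unfolding component_gap_def[abs_def]
  by (simp add: discrete_laplacian_diff discrete_laplacian_sum)

definition stencil :: "real \<Rightarrow> real \<times> real \<Rightarrow> (real \<times> real) set" where
  "stencil h z = {(fst z - h, snd z), (fst z + h, snd z), (fst z, snd z - h), (fst z, snd z + h)}"

lemma stencil_subset_mesh:
  assumes "z \<in> mesh_interior h N"
  shows "stencil h z \<subseteq> mesh h N" "z \<in> mesh h N"
proof -
  obtain i j where ij: "z = (real i * h, real j * h)" "1 \<le> i" "i \<le> N - 1" "1 \<le> j" "j \<le> N - 1"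
    using assms unfolding mesh_interior_def by auto
  have mem: "(real i' * h, real j' * h) \<in> mesh h N" if "i' \<le> N" "j' \<le> N" for i' j'
    using that unfolding mesh_def by blast
  have "real i * h - h = real (i - 1) * h" "real i * h + h = real (i + 1) * h"
    "real j * h - h = real (j - 1) * h" "real j * h + h = real (j + 1) * h"
    using ij by (simp_all add: of_nat_diff algebra_simps)
  then show "stencil h z \<subseteq> mesh h N" "z \<in> mesh h N"
    using ij mem[of "i - 1" j] mem[of "i + 1" j] mem[of i "j - 1"] mem[of i "j + 1"] mem[of i j]
    unfolding stencil_def by auto
qed

lemma discrete_laplacian_mono:
  assumes "\<And>y. y \<in> stencil h z \<Longrightarrow> v y \<le> w y" "w z \<le> v z"
  shows "discrete_laplacian h v z \<le> discrete_laplacian h w z"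
proof (cases z)
  case (Pair x y)
  then show ?thesis
    using assms(1)[of "(x - h, y)"] assms(1)[of "(x + h, y)"] assms(1)[of "(x, y - h)"]
      assms(1)[of "(x, y + h)"] assms(2)
    by (simp add: discrete_laplacian_def stencil_def divide_right_mono)
qed

text \<open>The discrete maximum principle in its elementary form; it only involves the five points of
  the stencil.\<close>

lemma discrete_laplacian_at_max:
  assumes "\<And>y. y \<in> stencil h z \<Longrightarrow> v y \<le> v z"
  shows "discrete_laplacian h v z \<le> 0"
proof -
  have "discrete_laplacian h v z \<le> discrete_laplacian h (\<lambda>_. v z) z"
    using assms by (intro discrete_laplacian_mono) auto
  also have "\<dots> = 0" by (cases z) (simp add: discrete_laplacian_def)
  finally show ?thesis .
qed

text \<open>A parabola in one coordinate has a constant discrete Laplacian and is nonnegative on the mesh; these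
  are the two properties that the comparison asks of a barrier.\<close>

definition barrier :: "real \<Rightarrow> real \<times> real \<Rightarrow> real" where
  "barrier a z = fst z * (a - fst z) / 2"

lemma discrete_laplacian_barrier:
  "h \<noteq> 0 \<Longrightarrow> discrete_laplacian h (barrier a) z = - 1"
  by (cases z) (simp add: discrete_laplacian_def barrier_def field_simps power2_eq_square)

lemma barrier_bounds:
  assumes "h = a / real N" "a > 0" "z \<in> mesh h N" "N \<ge> 1"
  shows "0 \<le> barrier a z" "barrier a z \<le> a\<^sup>2 / 8"
proof -
  obtain i j where "z = (real i * h, real j * h)" and i: "i \<le> N"
    using assms(3) unfolding mesh_def by auto
  then have i: "fst z = real i * h" "i \<le> N" by simp_all
  have "real i * h \<le> real N * h" using i assms by (intro mult_right_mono) auto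
  then have "0 \<le> fst z" "fst z \<le> a" using i assms by auto
  then show "0 \<le> barrier a z" unfolding barrier_def by simp
  have "0 \<le> (fst z - a / 2)\<^sup>2" by simp
  then show "barrier a z \<le> a\<^sup>2 / 8"
    unfolding barrier_def by (simp add: power2_eq_square field_simps)
qed

text \<open>At a maximum of \<open>g\<^sup>U\<^sub>l - g\<^sup>V\<^sub>l - \<kappa> b\<close> at which \<open>U\<^sub>l > 0\<close> the lower bound on \<open>L\<^sub>h g\<^sup>U\<^sub>l\<close> is
  available, and the upper bound on \<open>L\<^sub>h g\<^sup>V\<^sub>l\<close> always is. Segregation turns
  \<open>g\<^sup>V\<^sub>l < g\<^sup>U\<^sub>l\<close> into \<open>V\<^sub>l \<le> U\<^sub>l\<close>, so monotonicity orders the reaction terms favourably and only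
  \<open>- \<epsilon>1 - \<epsilon>2 + \<kappa> > 0\<close> remains.\<close>

lemma no_touching_at_positive:
  assumes U: "approx_discrete_solution h N m f \<epsilon>1 U" and V: "approx_discrete_solution h N m f \<epsilon>2 V"
    and \<kappa>: "\<epsilon>1 + \<epsilon>2 < \<kappa>" and h: "h \<noteq> 0"
    and z: "z \<in> mesh_interior h N" and l: "l \<in> {1..m}"
    and mono: "mono_on {0..} (f l z)"
    and pos: "0 < U l z" and gt: "component_gap m V l z < component_gap m U l z"
    and max: "\<And>y. y \<in> mesh h N \<Longrightarrow>
      component_gap m U l y - component_gap m V l y - \<kappa> * barrier a y
        \<le> component_gap m U l z - component_gap m V l z - \<kappa> * barrier a z"
  shows False
proof -
  note U' = U[unfolded approx_discrete_solution_def] and V' = V[unfolded approx_discrete_solution_def]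
  note zm = stencil_subset_mesh[OF z]
  have Ul: "component_gap m U l z = U l z"
    using U' zm(2) l pos by (intro component_gap_pos) auto
  have V0: "0 \<le> V l z"
    using V' zm(2) l unfolding segregated_on_def by auto
  have "V l z \<le> U l z"
  proof (cases "0 < V l z")
    case True
    then have "component_gap m V l z = V l z"
      using V' zm(2) l by (intro component_gap_pos) auto
    then show ?thesis using gt Ul by linarith
  next
    case False
    then show ?thesis using pos by linarith
  qed
  then have "f l z (V l z) \<le> f l z (U l z)"
    using mono V0 by (auto intro: mono_onD)
  moreover have "f l z (U l z) - \<epsilon>1 \<le> discrete_laplacian h (component_gap m U l) z"
    using U' l z pos by auto
  moreover have "discrete_laplacian h (component_gap m V l) z \<le> f l z (V l z) + \<epsilon>2"
    using V' l z by auto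
  moreover have "discrete_laplacian h
      (\<lambda>y. component_gap m U l y - component_gap m V l y - \<kappa> * barrier a y) z \<le> 0"
    using max zm(1) by (intro discrete_laplacian_at_max) auto
  then have "discrete_laplacian h (component_gap m U l) z - discrete_laplacian h (component_gap m V l) z + \<kappa> \<le> 0"
    by (simp add: discrete_laplacian_diff discrete_laplacian_cmult discrete_laplacian_barrier[OF h])
  ultimately show False using \<kappa> by linarith
qed

text \<open>If \<open>U\<^sub>l\<close> vanishes but \<open>g\<^sup>V\<^sub>l < g\<^sup>U\<^sub>l\<close>, then \<open>g\<^sup>V\<^sub>l\<close> is negative, so another component \<open>V\<^sub>q\<close> is
  positive. Then \<open>g\<^sup>V\<^sub>q = - g\<^sup>V\<^sub>l\<close> and \<open>g\<^sup>U\<^sub>q \<le> - g\<^sup>U\<^sub>l\<close>, so at \<open>q\<close> the difference with the roles of \<open>U\<close> and \<open>V\<close>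
  exchanged is at least as large.\<close>

lemma gap_attained_at_positive_aux:
  assumes U: "segregated_on A m U" and V: "segregated_on A m V" and z: "z \<in> A" and l: "l \<in> {1..m}"
    and gt: "component_gap m V l z < component_gap m U l z"
  shows "\<exists>q\<in>{1..m}.
    0 < U q z \<and> component_gap m U l z - component_gap m V l z \<le> component_gap m U q z - component_gap m V q z \<or>
    0 < V q z \<and> component_gap m U l z - component_gap m V l z \<le> component_gap m V q z - component_gap m U q z"
proof (cases "0 < U l z")
  case True
  then show ?thesis using l by auto
next
  case False
  then have "component_gap m V l z < 0"
    using component_gap_le[OF U z l] gt by linarith
  moreover have "0 \<le> V l z"
    using V z l unfolding segregated_on_def by auto
  ultimately have "0 < (\<Sum>p\<in>{1..m} - {l}. V p z)"
    unfolding component_gap_def by linarith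
  then obtain q where q: "q \<in> {1..m}" "q \<noteq> l" "0 < V q z"
    using sum_nonpos[of "{1..m} - {l}" "\<lambda>p. V p z"] by (force simp: not_less[symmetric])
  have "component_gap m V l z = - V q z" "component_gap m V q z = V q z"
    using component_gap_single[OF V z l q] component_gap_pos[OF V z q(1,3)] by auto
  then have "component_gap m U l z - component_gap m V l z \<le> component_gap m V q z - component_gap m U q z"
    using component_gap_add_le[OF _ l q(1,2), of U z] U z unfolding segregated_on_def by force
  then show ?thesis using q by blast
qed

lemma gap_attained_at_positive:
  assumes U: "segregated_on A m U" and V: "segregated_on A m V" and z: "z \<in> A" and l: "l \<in> {1..m}"
    and ne: "component_gap m U l z \<noteq> component_gap m V l z"
  obtains q where "q \<in> {1..m}" "0 < U q z"
      "\<bar>component_gap m U l z - component_gap m V l z\<bar> \<le> component_gap m U q z - component_gap m V q z"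
    | q where "q \<in> {1..m}" "0 < V q z"
      "\<bar>component_gap m U l z - component_gap m V l z\<bar> \<le> component_gap m V q z - component_gap m U q z"
proof (cases "component_gap m V l z < component_gap m U l z")
  case True
  then show ?thesis
    using gap_attained_at_positive_aux[OF U V z l True] that by auto
next
  case False
  then have "component_gap m U l z < component_gap m V l z" using ne by linarith
  then show ?thesis
    using gap_attained_at_positive_aux[OF V U z l] that by auto
qed

lemma component_gap_comparison:
  assumes U: "approx_discrete_solution h N m f \<epsilon>1 U" and V: "approx_discrete_solution h N m f \<epsilon>2 V"
    and \<kappa>: "\<epsilon>1 + \<epsilon>2 < \<kappa>" "0 \<le> \<kappa>" and h: "h = a / real N" and a: "a > 0" and N: "N \<ge> 1"
    and mono: "\<And>l z. l \<in> {1..m} \<Longrightarrow> z \<in> mesh_interior h N \<Longrightarrow> mono_on {0..} (f l z)"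
    and bdry: "\<And>l z. l \<in> {1..m} \<Longrightarrow> z \<in> mesh_boundary h N \<Longrightarrow> U l z = V l z"
    and l: "l \<in> {1..m}" and z: "z \<in> mesh h N"
  shows "\<bar>component_gap m U l z - component_gap m V l z\<bar> \<le> \<kappa> * barrier a z"
proof -
  have h0: "h \<noteq> 0" using h a N by auto
  define \<Phi> where "\<Phi> = (\<lambda>(l, y). \<bar>component_gap m U l y - component_gap m V l y\<bar> - \<kappa> * barrier a y)"
  have mesh_eq: "mesh h N = (\<lambda>(i, j). (real i * h, real j * h)) ` ({..N} \<times> {..N})"
    unfolding mesh_def by auto
  have fin: "finite ({1..m} \<times> mesh h N)"
    unfolding mesh_eq by auto
  have ne: "{1..m} \<times> mesh h N \<noteq> {}" using l z by auto
  define M where "M = Max (\<Phi> ` ({1..m} \<times> mesh h N))"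
  have "M \<in> \<Phi> ` ({1..m} \<times> mesh h N)"
    unfolding M_def by (intro Max_in) (use fin ne in auto)
  then obtain k y where k: "k \<in> {1..m}" and y: "y \<in> mesh h N" and M: "\<Phi> (k, y) = M" by auto
  \<comment> \<open>The maximum is joint over components and mesh points: at the maximizing point the component will be exchanged.\<close>
  have max: "\<Phi> (l', z') \<le> \<Phi> (k, y)" if "l' \<in> {1..m}" "z' \<in> mesh h N" for l' z'
    unfolding M unfolding M_def using fin that by (intro Max_ge) auto
  have "\<Phi> (k, y) \<le> 0"
  proof (rule ccontr)
    assume "\<not> \<Phi> (k, y) \<le> 0"
    then have pos: "\<kappa> * barrier a y < \<bar>component_gap m U k y - component_gap m V k y\<bar>"
      by (simp add: \<Phi>_def)
    have b0: "0 \<le> \<kappa> * barrier a y"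
      using barrier_bounds(1)[OF h a y N] \<kappa> by simp
    have seg: "segregated_on (mesh h N) m U" "segregated_on (mesh h N) m V"
      using U V unfolding approx_discrete_solution_def by auto
    have int: "y \<in> mesh_interior h N"
    proof (rule ccontr)
      assume "y \<notin> mesh_interior h N"
      then have "y \<in> mesh_boundary h N" using y unfolding mesh_boundary_def by auto
      then have "component_gap m U k y = component_gap m V k y"
        using bdry k unfolding component_gap_def by simp
      then show False using pos b0 by simp
    qed
    \<comment> \<open>Stated for a pair \<open>W, W'\<close> so that it applies to \<open>U, V\<close> and to \<open>V, U\<close>.\<close>
    have touch: False
      if W: "approx_discrete_solution h N m f \<epsilon> W" and W': "approx_discrete_solution h N m f \<epsilon>' W'"
        and \<epsilon>: "\<epsilon> + \<epsilon>' < \<kappa>" and q: "q \<in> {1..m}" "0 < W q y"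
        and le: "\<bar>component_gap m U k y - component_gap m V k y\<bar> \<le> component_gap m W q y - component_gap m W' q y"
        and abs: "\<And>z. \<bar>component_gap m W q z - component_gap m W' q z\<bar> = \<bar>component_gap m U q z - component_gap m V q z\<bar>"
      for W W' q \<epsilon> \<epsilon>'
    proof (rule no_touching_at_positive[OF W W' \<epsilon> h0 int q(1) mono[OF q(1) int] q(2)])
      show "component_gap m W' q y < component_gap m W q y"
        using le pos b0 by linarith
      fix z' assume z': "z' \<in> mesh h N"
      have "component_gap m W q z' - component_gap m W' q z' - \<kappa> * barrier a z' \<le> \<Phi> (q, z')"
        using abs[of z'] by (simp add: \<Phi>_def)
      also have "\<dots> \<le> \<Phi> (k, y)" by (rule max[OF q(1) z'])
      also have "\<dots> \<le> component_gap m W q y - component_gap m W' q y - \<kappa> * barrier a y"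
        using le by (simp add: \<Phi>_def)
      finally show "component_gap m W q z' - component_gap m W' q z' - \<kappa> * barrier a z'
        \<le> component_gap m W q y - component_gap m W' q y - \<kappa> * barrier a y" .
    qed
    have "component_gap m U k y \<noteq> component_gap m V k y" using pos b0 by auto
    then show False
    proof (rule gap_attained_at_positive[OF seg y k])
      fix q assume "q \<in> {1..m}" "0 < U q y"
        "\<bar>component_gap m U k y - component_gap m V k y\<bar> \<le> component_gap m U q y - component_gap m V q y"
      then show False using touch[OF U V \<kappa>(1)] by auto
    next
      fix q assume "q \<in> {1..m}" "0 < V q y"
        "\<bar>component_gap m U k y - component_gap m V k y\<bar> \<le> component_gap m V q y - component_gap m U q y"
      then show False using touch[OF V U, of q] \<kappa>(1) by (simp add: abs_minus_commute add.commute)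
    qed
  qed
  then show ?thesis using max[OF l z] by (simp add: \<Phi>_def)
qed

text \<open>The differences \<open>U\<^sub>l - V\<^sub>l\<close> are controlled by those of the gaps, and the gaps by \<open>\<kappa> b\<close> for every
  \<open>\<kappa>\<close> above the total error; the bound with the total error itself is the limit.\<close>

theorem discrete_comparison:
  assumes U: "approx_discrete_solution h N m f \<epsilon>1 U" and V: "approx_discrete_solution h N m f \<epsilon>2 V"
    and \<epsilon>: "0 \<le> \<epsilon>1 + \<epsilon>2" and h: "h = a / real N" and a: "a > 0" and N: "N \<ge> 1"
    and mono: "\<And>l z. l \<in> {1..m} \<Longrightarrow> z \<in> mesh_interior h N \<Longrightarrow> mono_on {0..} (f l z)"
    and bdry: "\<And>l z. l \<in> {1..m} \<Longrightarrow> z \<in> mesh_boundary h N \<Longrightarrow> U l z = V l z"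
    and l: "l \<in> {1..m}" and z: "z \<in> mesh h N"
  shows "\<bar>U l z - V l z\<bar> \<le> a\<^sup>2 / 8 * (\<epsilon>1 + \<epsilon>2)"
proof -
  have seg: "segregated_on (mesh h N) m U" "segregated_on (mesh h N) m V"
    using U V unfolding approx_discrete_solution_def by auto
  let ?d = "\<bar>component_gap m U l z - component_gap m V l z\<bar>"
  have one_sided: "W l z - W' l z \<le> \<bar>component_gap m W l z - component_gap m W' l z\<bar>"
    if "segregated_on (mesh h N) m W" "segregated_on (mesh h N) m W'" for W W'
  proof (cases "0 < W l z")
    case True
    then show ?thesis
      using component_gap_pos[OF that(1) z l True] component_gap_le[OF that(2) z l] by linarith
  next
    case False
    moreover have "0 \<le> W' l z" using that(2) z l unfolding segregated_on_def by auto
    ultimately show ?thesis by linarith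
  qed
  have "\<bar>U l z - V l z\<bar> \<le> ?d"
    using one_sided[OF seg] one_sided[OF seg(2,1)] by linarith
  also have "?d \<le> (\<epsilon>1 + \<epsilon>2) * (a\<^sup>2 / 8)"
  proof -
    have "?d / (a\<^sup>2 / 8) \<le> \<kappa>" if "\<epsilon>1 + \<epsilon>2 < \<kappa>" for \<kappa>
    proof -
      have "?d \<le> \<kappa> * barrier a z"
        using \<epsilon> that by (intro component_gap_comparison[OF U V that _ h a N mono bdry l z]) auto
      also have "\<dots> \<le> \<kappa> * (a\<^sup>2 / 8)"
        using \<epsilon> that by (intro mult_left_mono barrier_bounds[OF h a z N]) auto
      finally show ?thesis using a by (simp add: pos_divide_le_eq)
    qed
    then have "?d / (a\<^sup>2 / 8) \<le> \<epsilon>1 + \<epsilon>2" by (rule dense_ge)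
    then show ?thesis using a by (simp add: pos_divide_le_eq)
  qed
  finally show ?thesis by (simp add: mult.commute)
qed


section \<open>Solutions of the scheme\<close>

lemma nbr_average_eq:
  "h \<noteq> 0 \<Longrightarrow> nbr_average h v z = v z + h\<^sup>2 / 4 * discrete_laplacian h v z"
  by (cases z) (simp add: nbr_average_def discrete_laplacian_def field_simps)

lemma nbr_average_component_gap:
  "nbr_average h (component_gap m w l) z =
    nbr_average h (w l) z - (\<Sum>p\<in>{1..m} - {l}. nbr_average h (w p) z)"
  by (cases z) (simp add: nbr_average_def component_gap_def sum.distrib sum_subtractf
      sum_divide_distrib[symmetric] diff_divide_distrib[symmetric])

lemma nbr_average_mono:
  assumes "\<And>y. y \<in> stencil h z \<Longrightarrow> v y \<le> w y"
  shows "nbr_average h v z \<le> nbr_average h w z"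
proof (cases z)
  case (Pair x y)
  then show ?thesis
    using assms[of "(x - h, y)"] assms[of "(x + h, y)"] assms[of "(x, y - h)"]
      assms[of "(x, y + h)"]
    by (simp add: nbr_average_def stencil_def)
qed

text \<open>Since the reaction terms are nonnegative, two components positive at the same point would each be
  bounded by the average of its own gap; but the averages of two different gaps have nonpositive
  sum. This gives segregation. Where \<open>v\<^sub>l\<close> vanishes and another component \<open>v\<^sub>p\<close> is positive, the
  same comparison of averages gives \<open>L\<^sub>h g\<^sub>l \<le> - L\<^sub>h g\<^sub>p = - f\<^sub>p \<le> 0\<close>.\<close>

lemma discrete_solution_is_approx:
  assumes v: "discrete_solution h N m f \<phi> v" and h: "h > 0"
    and f: "\<And>l z s. l \<in> {1..m} \<Longrightarrow> z \<in> mesh_interior h N \<Longrightarrow> 0 \<le> s \<Longrightarrow> 0 \<le> f l z s"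
    and \<phi>: "segregated_on (mesh_boundary h N) m \<phi>"
  shows "approx_discrete_solution h N m f 0 v"
proof -
  have int: "v l z = max (- (h\<^sup>2 / 4) * f l z (v l z) + nbr_average h (component_gap m v l) z) 0"
    if "l \<in> {1..m}" "z \<in> mesh_interior h N" for l z
    using v that unfolding discrete_solution_def nbr_average_component_gap
    by (simp only: add_diff_eq)
  have bd: "v l z = \<phi> l z" if "l \<in> {1..m}" "z \<in> mesh_boundary h N" for l z
    using v that unfolding discrete_solution_def by auto
  have split: "z \<in> mesh_interior h N \<or> z \<in> mesh_boundary h N" if "z \<in> mesh h N" for z
    using that unfolding mesh_boundary_def by auto
  have nonneg: "0 \<le> v l z" if "l \<in> {1..m}" "z \<in> mesh h N" for l z
    using split[OF that(2)] int[OF that(1)] bd[OF that(1)] \<phi> that(1) unfolding segregated_on_def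
    by (metis max.cobounded2)
  have gap_sum: "component_gap m v p y \<le> - component_gap m v l y"
    if "l \<in> {1..m}" "p \<in> {1..m}" "l \<noteq> p" "y \<in> mesh h N" for l p y
    using that nonneg by (intro component_gap_add_le) auto
  have avg_neg: "nbr_average h (component_gap m v p) z \<le> - nbr_average h (component_gap m v l) z"
    if "l \<in> {1..m}" "p \<in> {1..m}" "l \<noteq> p" "z \<in> mesh_interior h N" for l p z
  proof -
    have "nbr_average h (component_gap m v p) z \<le> nbr_average h (\<lambda>y. - component_gap m v l y) z"
      using gap_sum[OF that(1-3)] stencil_subset_mesh[OF that(4)] by (intro nbr_average_mono) auto
    also have "\<dots> = - nbr_average h (component_gap m v l) z"
      by (cases z) (simp add: nbr_average_def minus_divide_left)
    finally show ?thesis .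
  qed
  have hf: "0 \<le> h\<^sup>2 / 4 * f l z (v l z)" if "l \<in> {1..m}" "z \<in> mesh_interior h N" for l z
    using f[OF that] nonneg[OF that(1)] stencil_subset_mesh(2)[OF that(2)] by simp
  have seg: "segregated_on (mesh h N) m v"
    unfolding segregated_on_def
  proof (intro conjI ballI impI)
    fix l p z assume lp: "l \<in> {1..m}" "p \<in> {1..m}" "l \<noteq> p" and z: "z \<in> mesh h N"
    show "v l z = 0 \<or> v p z = 0"
    proof (cases "z \<in> mesh_interior h N")
      case True
      show ?thesis
        using int[OF lp(1) True] int[OF lp(2) True] hf[OF lp(1) True] hf[OF lp(2) True] avg_neg[OF lp True]
        by (auto simp: max_def split: if_splits)
    next
      case False
      then show ?thesis
        using split[OF z] bd lp \<phi> unfolding segregated_on_def by metis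
    qed
  qed (use nonneg in auto)
  have h2: "h\<^sup>2 / 4 > 0" using h by simp
  have lap: "discrete_laplacian h (component_gap m v l) z =
      (nbr_average h (component_gap m v l) z - component_gap m v l z) / (h\<^sup>2 / 4)" for l z
    using nbr_average_eq[of h "component_gap m v l" z] h by simp
  have eq: "discrete_laplacian h (component_gap m v l) z = f l z (v l z)"
    if l: "l \<in> {1..m}" and z: "z \<in> mesh_interior h N" and pos: "0 < v l z" for l z
  proof -
    have "component_gap m v l z = v l z"
      using component_gap_pos[OF seg stencil_subset_mesh(2)[OF z] l pos] .
    moreover have "v l z = - (h\<^sup>2 / 4) * f l z (v l z) + nbr_average h (component_gap m v l) z"
      using int[OF l z] pos by (auto simp: max_def split: if_splits)
    ultimately show ?thesis
      using h2 by (simp add: lap field_simps)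
  qed
  have "discrete_laplacian h (component_gap m v l) z \<le> f l z (v l z)"
    if l: "l \<in> {1..m}" and z: "z \<in> mesh_interior h N" for l z
  proof (cases "\<exists>p\<in>{1..m}. 0 < v p z")
    case True
    then obtain p where p: "p \<in> {1..m}" "0 < v p z" by auto
    show ?thesis
    proof (cases "p = l")
      case True
      then show ?thesis using eq[OF l z] p by simp
    next
      case False
      have zm: "z \<in> mesh h N" using stencil_subset_mesh(2)[OF z] .
      have "component_gap m v l z = - component_gap m v p z"
        using component_gap_single[OF seg zm l p(1) False p(2)] component_gap_pos[OF seg zm p] by simp
      then have "discrete_laplacian h (component_gap m v l) z \<le> - discrete_laplacian h (component_gap m v p) z"
        unfolding lap minus_divide_left using avg_neg[OF p(1) l False z] h2
        by (intro divide_right_mono) linarith+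
      also have "\<dots> = - f p z (v p z)" using eq[OF p(1) z p(2)] by simp
      also have "\<dots> \<le> 0" using f[OF p(1) z] p(2) by simp
      also have "\<dots> \<le> f l z (v l z)" using f[OF l z nonneg[OF l zm]] .
      finally show ?thesis .
    qed
  next
    case False
    then have 0: "v p z = 0" if "p \<in> {1..m}" for p
      using nonneg[OF that stencil_subset_mesh(2)[OF z]] that by force
    have "component_gap m v l z = 0"
      unfolding component_gap_def using 0 l by simp
    moreover have "- (h\<^sup>2 / 4) * f l z (v l z) + nbr_average h (component_gap m v l) z \<le> 0"
      using int[OF l z] 0[OF l] by (auto simp: max_def split: if_splits)
    ultimately show ?thesis
      unfolding lap using h2 by (simp add: field_simps)
  qed
  then show ?thesis
    unfolding approx_discrete_solution_def using seg eq by auto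
qed


section \<open>Partial derivatives and smooth functions\<close>

lemma partial_eqI: "(v has_derivative D) (at x) \<Longrightarrow> partial b v x = D b"
  unfolding partial_def by (metis frechet_derivative_at)

text \<open>The two functions need to agree only on an open set, because their Frechet derivatives are
  chosen from equal sets of derivatives.\<close>

lemma partial_cong_open:
  assumes "open S" "x \<in> S" "\<And>y. y \<in> S \<Longrightarrow> v y = w y"
  shows "partial b v x = partial b w x"
proof -
  have "(v has_derivative D) (at x) \<longleftrightarrow> (w has_derivative D) (at x)" for D
    using has_derivative_transform_within_open[OF _ assms(1,2), of v D UNIV w]
      has_derivative_transform_within_open[OF _ assms(1,2), of w D UNIV v] assms(3) by auto
  then show ?thesis
    unfolding partial_def frechet_derivative_def by simp
qed

lemma has_derivative_partial:
  assumes "v differentiable (at x)"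
  shows "(v has_derivative (\<lambda>b. partial b v x)) (at x)"
  using assms unfolding partial_def by (simp add: frechet_derivative_works)

lemma has_real_derivative_along_line:
  assumes "v differentiable (at (z + t *\<^sub>R e))"
  shows "((\<lambda>s. v (z + s *\<^sub>R e)) has_real_derivative partial e v (z + t *\<^sub>R e)) (at t)"
proof -
  have v: "(v has_derivative (\<lambda>b. partial b v (z + t *\<^sub>R e))) (at (z + t *\<^sub>R e))"
    by (rule has_derivative_partial[OF assms])
  have l: "((\<lambda>s. z + s *\<^sub>R e) has_derivative (\<lambda>s. s *\<^sub>R e)) (at t)"
    by (auto intro!: derivative_eq_intros)
  have "((\<lambda>s. v (z + s *\<^sub>R e)) has_derivative (\<lambda>s. partial (s *\<^sub>R e) v (z + t *\<^sub>R e))) (at t)"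
    using has_derivative_compose[OF l v] .
  moreover have "partial (s *\<^sub>R e) v (z + t *\<^sub>R e) = s *\<^sub>R partial e v (z + t *\<^sub>R e)" for s
    using linear_cmul[OF has_derivative_linear[OF v]] .
  ultimately show ?thesis unfolding has_field_derivative_def by (simp add: mult_commute_abs)
qed

lemma partial_add:
  assumes "v differentiable (at x)" "w differentiable (at x)"
  shows "partial b (\<lambda>y. v y + w y) x = partial b v x + partial b w x"
  by (rule partial_eqI)
    (intro has_derivative_add has_derivative_partial assms)

lemma partial_mult:
  assumes "v differentiable (at x)" "w differentiable (at x)"
  shows "partial b (\<lambda>y. v y * w y) x = partial b v x * w x + v x * partial b w x"
  using partial_eqI[OF has_derivative_mult[OF has_derivative_partial[OF assms(1)]
      has_derivative_partial[OF assms(2)]], of b] by (simp add: add.commute)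

lemma partial_cmult:
  assumes "v differentiable (at x)"
  shows "partial b (\<lambda>y. c * v y) x = c * partial b v x"
  by (rule partial_eqI) (intro has_derivative_mult_right has_derivative_partial assms)

lemma partial_const: "partial b (\<lambda>y. c) x = 0"
  by (rule partial_eqI) auto

lemma Ck_SucD: "Ck (Suc k) S v \<Longrightarrow> Ck k S v"
proof (induction k arbitrary: v)
  case 0
  then show ?case
    by (auto simp: continuous_on_eq_continuous_within
        intro!: continuous_at_imp_continuous_at_within[OF differentiable_imp_continuous_within])
next
  case (Suc k)
  then show ?case by auto
qed

lemma Ck_const: "Ck k UNIV (\<lambda>x. c)"
proof (induction k arbitrary: c)
  case (Suc k)
  then show ?case by (simp add: partial_const[abs_def])
qed auto

lemma Ck_add: "Ck k UNIV v \<Longrightarrow> Ck k UNIV w \<Longrightarrow> Ck k UNIV (\<lambda>x. v x + w x)"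
proof (induction k arbitrary: v w)
  case (Suc k)
  have "partial b (\<lambda>y. v y + w y) = (\<lambda>x. partial b v x + partial b w x)" for b
    using Suc.prems by (intro ext partial_add) auto
  then show ?case using Suc by auto
qed (auto intro: continuous_on_add)

lemma Ck_mult: "Ck k UNIV v \<Longrightarrow> Ck k UNIV w \<Longrightarrow> Ck k UNIV (\<lambda>x. v x * w x)"
proof (induction k arbitrary: v w)
  case (Suc k)
  have "partial b (\<lambda>y. v y * w y) = (\<lambda>x. partial b v x * w x + v x * partial b w x)" for b
    using Suc.prems by (intro ext partial_mult) auto
  then show ?case using Suc Ck_SucD[OF Suc.prems(1)] Ck_SucD[OF Suc.prems(2)]
    by (auto intro!: Ck_add)
qed (auto intro: continuous_on_mult)

lemma smooth_const: "smooth (\<lambda>x. c)"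
  by (simp add: smooth_def Ck_const)

lemma smooth_add: "smooth v \<Longrightarrow> smooth w \<Longrightarrow> smooth (\<lambda>x. v x + w x)"
  by (simp add: smooth_def Ck_add)

lemma smooth_mult: "smooth v \<Longrightarrow> smooth w \<Longrightarrow> smooth (\<lambda>x. v x * w x)"
  by (simp add: smooth_def Ck_mult)

lemma smooth_prod:
  assumes "finite I" "\<And>i. i \<in> I \<Longrightarrow> smooth (v i)"
  shows "smooth (\<lambda>x. \<Prod>i\<in>I. v i x)"
  using assms by (induction I) (auto simp: smooth_const smooth_mult)

lemma smooth_differentiable: "smooth v \<Longrightarrow> v differentiable (at x)"
  unfolding smooth_def by (metis Ck.simps(2) UNIV_I)

lemma smooth_partial: "smooth v \<Longrightarrow> b \<in> Basis \<Longrightarrow> smooth (partial b v)"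
  unfolding smooth_def by (metis Ck.simps(2))

lemma smooth_continuous_on: "smooth v \<Longrightarrow> continuous_on A v"
  unfolding smooth_def by (metis Ck.simps(1) continuous_on_subset subset_UNIV)


section \<open>Smooth bump functions\<close>

text \<open>The family \<open>t \<mapsto> P(1/t) exp(-1/t)\<close>, extended by zero to \<open>t \<le> 0\<close>, with \<open>P\<close> any polynomial: it is
  closed under differentiation, which makes smoothness an induction.\<close>

definition flat :: "real poly \<Rightarrow> real \<Rightarrow> real" where
  "flat p t = (if t > 0 then poly p (1 / t) * exp (- (1 / t)) else 0)"

lemma poly_div_exp_tendsto_0: "((\<lambda>y::real. poly p y / exp y) \<longlongrightarrow> 0) at_top"
proof -
  have "((\<lambda>y::real. \<Sum>i\<le>degree p. coeff p i * (y ^ i / exp y)) \<longlongrightarrow> (\<Sum>i\<le>degree p. coeff p i * 0)) at_top"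
    by (intro tendsto_sum tendsto_mult tendsto_const tendsto_power_div_exp_0)
  then show ?thesis
    by (simp add: poly_altdef sum_divide_distrib)
qed

lemma flat_has_field_derivative:
  "(flat p has_field_derivative flat (monom 1 2 * (p - pderiv p)) t) (at t)"
proof -
  consider "t > 0" | "t < 0" | "t = 0" by linarith
  then show ?thesis
  proof cases
    case 1
    have "((\<lambda>t. poly p (1 / t) * exp (- (1 / t))) has_field_derivative
        flat (monom 1 2 * (p - pderiv p)) t) (at t)"
      using 1
      by (auto intro!: derivative_eq_intros poly_DERIV DERIV_chain'[where g = "poly p"]
          simp: flat_def poly_monom field_simps power2_eq_square)
    then show ?thesis
      by (rule has_field_derivative_transform_within_open[where S = "{0<..}"])
        (use 1 in \<open>auto simp: flat_def\<close>)
  next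
    case 2
    have "((\<lambda>t. 0) has_field_derivative flat (monom 1 2 * (p - pderiv p)) t) (at t)"
      using 2 by (auto simp: flat_def)
    then show ?thesis
      by (rule has_field_derivative_transform_within_open[where S = "{..<0}"])
        (use 2 in \<open>auto simp: flat_def\<close>)
  next
    case 3
    have "((\<lambda>y. poly (pCons 0 p) y / exp y) \<longlongrightarrow> 0) at_top"
      by (rule poly_div_exp_tendsto_0)
    then have "((\<lambda>y. flat p (inverse y) / inverse y) \<longlongrightarrow> 0) at_top"
      by (rule Lim_transform_eventually)
        (auto intro!: eventually_mono[OF eventually_gt_at_top[of 0]]
          simp: flat_def exp_minus field_simps)
    then have r: "((\<lambda>y. flat p y / y) \<longlongrightarrow> 0) (at_right 0)"
      by (simp add: filterlim_at_right_to_top)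
    have "((\<lambda>y. 0) \<longlongrightarrow> (0::real)) (at_left (0::real))" by simp
    then have l: "((\<lambda>y. flat p y / y) \<longlongrightarrow> 0) (at_left 0)"
      by (rule Lim_transform_eventually)
        (auto simp: flat_def eventually_at_filter)
    have "((\<lambda>y. flat p y / y) \<longlongrightarrow> 0) (at 0)"
      by (rule filterlim_split_at[OF l r])
    then show ?thesis using 3
      by (simp add: has_field_derivative_iff flat_def)
  qed
qed

lemma Ck_flat_affine: "Ck k UNIV (\<lambda>x. flat p (c \<bullet> x + d))"
proof (induction k arbitrary: p)
  case 0
  show ?case
    using continuous_on_compose2[of UNIV "flat p" UNIV "\<lambda>x. c \<bullet> x + d"]
    by (simp add: DERIV_isCont[OF flat_has_field_derivative] continuous_on_eq_continuous_at
        continuous_intros)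
next
  case (Suc k)
  define q where "q = monom 1 2 * (p - pderiv p)"
  have *: "((\<lambda>x. flat p (c \<bullet> x + d)) has_derivative (\<lambda>b. (c \<bullet> b) * flat q (c \<bullet> x + d))) (at x)" for x
    unfolding q_def
    by (rule has_derivative_eq_rhs[OF has_derivative_compose[OF _
            flat_has_field_derivative[unfolded has_field_derivative_def]]])
       (auto intro!: derivative_eq_intros simp: mult.commute)
  have "partial b (\<lambda>x. flat p (c \<bullet> x + d)) = (\<lambda>x. (c \<bullet> b) * flat q (c \<bullet> x + d))" for b
    using partial_eqI[OF *] by auto
  then show ?case
    using Suc * by (auto intro!: Ck_mult Ck_const differentiableI)
qed

text \<open>On the open box between \<open>p\<close> and \<open>q\<close> this is the exponential of \<open>-1/k\<close> times a positive
  function, so it increases to the indicator of the box as \<open>k\<close> grows.\<close>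

definition bump :: "real \<Rightarrow> 'a::euclidean_space \<Rightarrow> 'a \<Rightarrow> 'a \<Rightarrow> real" where
  "bump k p q x = (\<Prod>b\<in>Basis. flat 1 (k * (x \<bullet> b - p \<bullet> b)) * flat 1 (k * (q \<bullet> b - x \<bullet> b)))"

lemma flat_1: "flat 1 t = (if t > 0 then exp (- (1 / t)) else 0)"
  by (simp add: flat_def)

lemma smooth_bump: "smooth (bump k p q)"
proof -
  have 1: "smooth (\<lambda>x::'a. flat 1 (k * (x \<bullet> b - p \<bullet> b)))" for b
    using Ck_flat_affine[of _ 1 "k *\<^sub>R b" "- k * (p \<bullet> b)"]
    by (simp add: smooth_def algebra_simps inner_commute)
  have 2: "smooth (\<lambda>x::'a. flat 1 (k * (q \<bullet> b - x \<bullet> b)))" for b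
    using Ck_flat_affine[of _ 1 "- k *\<^sub>R b" "k * (q \<bullet> b)"]
    by (simp add: smooth_def algebra_simps inner_commute)
  show ?thesis
    unfolding bump_def[abs_def] by (intro smooth_prod smooth_mult 1 2) auto
qed

lemma bump_nonneg: "0 \<le> bump k p q x"
  unfolding bump_def by (intro prod_nonneg) (auto simp: flat_1)

lemma bump_le_1: "bump k p q x \<le> 1"
  unfolding bump_def by (intro prod_le_1) (auto simp: flat_1 intro!: mult_le_one)

lemma bump_pos_iff: "k > 0 \<Longrightarrow> 0 < bump k p q x \<longleftrightarrow> x \<in> box p q"
proof -
  assume k: "k > 0"
  have "0 < bump k p q x \<longleftrightarrow> bump k p q x \<noteq> 0"
    using bump_nonneg[of k p q x] by linarith
  also have "\<dots> \<longleftrightarrow> x \<in> box p q"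
    using k by (auto simp: bump_def flat_1 mem_box zero_less_mult_iff)
  finally show ?thesis .
qed

lemma bump_eq_0: "k > 0 \<Longrightarrow> x \<notin> box p q \<Longrightarrow> bump k p q x = 0"
  using bump_pos_iff[of k p q x] bump_nonneg[of k p q x] by linarith

lemma bump_tendsto_1:
  assumes "x \<in> box p q"
  shows "(\<lambda>n. bump (real (Suc n)) p q x) \<longlonglongrightarrow> 1"
proof -
  have *: "(\<lambda>n. flat 1 (real (Suc n) * r)) \<longlonglongrightarrow> 1" if "r > 0" for r
  proof -
    have "(\<lambda>n. 1 / r * (1 / real (Suc n))) \<longlonglongrightarrow> 1 / r * 0"
      by (intro tendsto_mult tendsto_const LIMSEQ_Suc lim_1_over_n)
    then have "(\<lambda>n. exp (- (1 / r * (1 / real (Suc n))))) \<longlonglongrightarrow> exp (- (1 / r * 0))"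
      by (intro tendsto_exp tendsto_minus)
    then show ?thesis
      using that by (simp add: flat_1 mult.commute zero_less_mult_iff)
  qed
  have "(\<lambda>n. bump (real (Suc n)) p q x) \<longlonglongrightarrow> (\<Prod>b\<in>(Basis::'a set). 1 * 1)"
    unfolding bump_def using assms
    by (intro tendsto_prod tendsto_mult *) (auto simp: mem_box)
  then show ?thesis by simp
qed

lemma test_function_bump:
  assumes "k > 0" "cbox p q \<subseteq> S"
  shows "test_function S (bump k p q)"
proof -
  have "{x. bump k p q x \<noteq> 0} \<subseteq> cbox p q"
    using bump_eq_0[OF assms(1)] box_subset_cbox[of p q] by blast
  then have "closure {x. bump k p q x \<noteq> 0} \<subseteq> cbox p q"
    by (intro closure_minimal) auto
  moreover from this have "compact (closure {x. bump k p q x \<noteq> 0})"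
    using bounded_subset[OF bounded_cbox] by (auto simp: compact_eq_bounded_closed)
  ultimately show ?thesis
    using assms(2) smooth_bump[of k p q] unfolding test_function_def by auto
qed


section \<open>The fundamental lemma of the calculus of variations\<close>

text \<open>Dominated convergence along \<open>bump k p q\<close>.\<close>

lemma integral_box_eq_0_if_test_functions:
  fixes d :: "'a::euclidean_space \<Rightarrow> real"
  assumes d: "locally_integrable_on S d"
    and 0: "\<And>\<psi>. test_function S \<psi> \<Longrightarrow> (LINT x:S|lebesgue. d x * \<psi> x) = 0"
    and S: "cbox p q \<subseteq> S"
  shows "integral (cbox p q) d = 0"
proof -
  define \<psi> where "\<psi> n = bump (real (Suc n)) p q" for n
  have int: "set_integrable lebesgue (cbox p q) d"
    using d S unfolding locally_integrable_on_def by auto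
  have int': "set_integrable lebesgue (box p q) d"
    by (rule set_integrable_subset[OF int]) (auto simp: box_subset_cbox)
  have \<psi>_meas: "\<psi> n \<in> borel_measurable lebesgue" for n
    unfolding \<psi>_def
    by (intro measurable_completion)
      (simp add: borel_measurable_continuous_onI[OF smooth_continuous_on[OF smooth_bump]])
  have d_meas: "(\<lambda>x. indicat_real (cbox p q) x * d x) \<in> borel_measurable lebesgue"
    using int unfolding set_integrable_def by auto
  have "(\<lambda>n. LINT x|lebesgue. (indicat_real (cbox p q) x * d x) * \<psi> n x) \<longlonglongrightarrow>
      (LINT x|lebesgue. indicat_real (box p q) x * d x)"
  proof (rule integral_dominated_convergence[where w = "\<lambda>x. norm (indicat_real (cbox p q) x * d x)"])
    show "(\<lambda>x. indicat_real (box p q) x * d x) \<in> borel_measurable lebesgue"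
      using int' unfolding set_integrable_def by auto
    show "(\<lambda>x. (indicat_real (cbox p q) x * d x) * \<psi> n x) \<in> borel_measurable lebesgue" for n
      by (intro borel_measurable_times d_meas \<psi>_meas)
    show "integrable lebesgue (\<lambda>x. norm (indicat_real (cbox p q) x * d x))"
      using int unfolding set_integrable_def by auto
    have "(\<lambda>n. (indicat_real (cbox p q) x * d x) * \<psi> n x) \<longlonglongrightarrow> indicat_real (box p q) x * d x" for x
    proof (cases "x \<in> box p q")
      case True
      then have "(\<lambda>n. (indicat_real (cbox p q) x * d x) * \<psi> n x) \<longlonglongrightarrow> (indicat_real (cbox p q) x * d x) * 1"
        unfolding \<psi>_def by (intro tendsto_mult tendsto_const bump_tendsto_1)
      moreover have "x \<in> cbox p q"
        using True box_subset_cbox[of p q] by blast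
      ultimately show ?thesis using True by simp
    next
      case False
      then show ?thesis unfolding \<psi>_def by (simp add: bump_eq_0 del: of_nat_Suc)
    qed
    then show "AE x in lebesgue. (\<lambda>n. (indicat_real (cbox p q) x * d x) * \<psi> n x) \<longlonglongrightarrow> indicat_real (box p q) x * d x"
      by simp
    have "\<bar>d x\<bar> * \<bar>\<psi> n x\<bar> \<le> \<bar>d x\<bar>" for n x
      using bump_nonneg[of "real (Suc n)" p q x] bump_le_1[of "real (Suc n)" p q x] unfolding \<psi>_def
      by (intro mult_left_le) auto
    then show "AE x in lebesgue. norm ((indicat_real (cbox p q) x * d x) * \<psi> n x)
        \<le> norm (indicat_real (cbox p q) x * d x)" for n
      by (auto simp: abs_mult indicator_def)
  qed
  moreover have "(LINT x|lebesgue. (indicat_real (cbox p q) x * d x) * \<psi> n x) = 0" for n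
  proof -
    have "(LINT x|lebesgue. (indicat_real (cbox p q) x * d x) * \<psi> n x) = (LINT x:S|lebesgue. d x * \<psi> n x)"
      unfolding set_lebesgue_integral_def
    proof (rule Bochner_Integration.integral_cong[OF refl])
      fix x
      show "indicat_real (cbox p q) x * d x * \<psi> n x = indicat_real S x *\<^sub>R (d x * \<psi> n x)"
      proof (cases "x \<in> box p q")
        case True
        then have "x \<in> cbox p q" using box_subset_cbox[of p q] by blast
        then show ?thesis using S by auto
      next
        case False
        then show ?thesis unfolding \<psi>_def by (simp add: bump_eq_0 del: of_nat_Suc)
      qed
    qed
    also have "\<dots> = 0"
      unfolding \<psi>_def by (intro 0 test_function_bump S) auto
    finally show ?thesis .
  qed
  ultimately have "(LINT x:box p q|lebesgue. d x) = 0"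
    unfolding set_lebesgue_integral_def by (simp add: LIMSEQ_const_iff)
  then show ?thesis
    using set_lebesgue_integral_eq_integral(2)[OF int'] by (simp add: integral_open_interval)
qed

text \<open>The integral of \<open>d\<close> over every closed box inside \<open>S\<close> vanishes, and almost every value of a locally
  integrable function is the limit of its means over shrinking cubes.\<close>

lemma fundamental_lemma:
  fixes d :: "'a::euclidean_space \<Rightarrow> real"
  assumes S: "open S" and d: "locally_integrable_on S d"
    and 0: "\<And>\<psi>. test_function S \<psi> \<Longrightarrow> (LINT x:S|lebesgue. d x * \<psi> x) = 0"
  shows "AE x in lebesgue. x \<in> S \<longrightarrow> d x = 0"
proof -
  have *: "negligible {x \<in> cbox p q. d x \<noteq> 0}" if pq: "cbox p q \<subseteq> S" for p q
  proof -
    define f where "f x = (if x \<in> cbox p q then d x else 0)" for x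
    have "set_integrable lebesgue (cbox p q) d"
      using d pq unfolding locally_integrable_on_def by auto
    then have "d integrable_on cbox p q"
      by (rule set_lebesgue_integral_eq_integral)
    then have "f integrable_on UNIV"
      unfolding f_def by (simp only: integrable_restrict_UNIV)
    then have "f integrable_on cbox r s" for r s
      using integrable_on_subcbox by blast
    then obtain N where N: "negligible N" and lim: "\<And>x e. x \<notin> N \<Longrightarrow> 0 < e \<Longrightarrow>
        \<exists>\<delta>>0. \<forall>h. 0 < h \<and> h < \<delta> \<longrightarrow>
          norm (integral (cbox x (x + h *\<^sub>R One)) f /\<^sub>R h ^ DIM('a) - f x) < e"
      by (rule integrable_ccontinuous_explicit) blast
    have "{x \<in> cbox p q. d x \<noteq> 0} \<subseteq> N \<union> (cbox p q - box p q)"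
    proof (rule ccontr)
      assume "\<not> ?thesis"
      then obtain x where x: "x \<in> box p q" "d x \<noteq> 0" "x \<notin> N" by auto
      then have fx: "f x = d x" using box_subset_cbox[of p q] by (auto simp: f_def)
      obtain \<delta> where \<delta>: "\<delta> > 0" "\<forall>h. 0 < h \<and> h < \<delta> \<longrightarrow>
          norm (integral (cbox x (x + h *\<^sub>R One)) f /\<^sub>R h ^ DIM('a) - f x) < \<bar>d x\<bar>"
        using lim[OF x(3), of "\<bar>d x\<bar>"] x(2) by auto
      obtain e where e: "e > 0" "ball x e \<subseteq> box p q"
        using x(1) open_box open_contains_ball by blast
      \<comment> \<open>Below \<open>\<delta>\<close> for the estimate of the means, and so small that the cube stays inside the box.\<close>
      define h where "h = min (\<delta> / 2) (e / 2 / (norm (One::'a) + 1))"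
      have h: "0 < h" "h < \<delta>" and he: "h * norm (One::'a) < e"
      proof -
        show "0 < h" using \<delta>(1) e(1) by (simp add: h_def add_nonneg_pos)
        have "h \<le> \<delta> / 2" unfolding h_def by (rule min.cobounded1)
        then show "h < \<delta>" using \<delta>(1) by linarith
        have "h * (norm (One::'a) + 1) \<le> e / 2 / (norm (One::'a) + 1) * (norm (One::'a) + 1)"
          by (intro mult_right_mono) (auto simp: h_def)
        also have "\<dots> = e / 2"
        proof -
          have "norm (One::'a) + 1 \<noteq> 0" using norm_ge_zero[of "One::'a"] by linarith
          then show ?thesis by (rule nonzero_eq_divide_eq[THEN iffD1, OF _ refl])
        qed
        finally show "h * norm (One::'a) < e" using \<open>0 < h\<close> e(1) by (simp add: algebra_simps)
      qed
      have sub: "cbox x (x + h *\<^sub>R One) \<subseteq> box p q"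
      proof -
        have "cbox x (x + h *\<^sub>R One) \<subseteq> ball x e"
        proof
          fix y assume y: "y \<in> cbox x (x + h *\<^sub>R One)"
          have "norm (y - x) \<le> norm (h *\<^sub>R (One::'a))"
            using y by (intro norm_le_componentwise) (auto simp: mem_box algebra_simps)
          then show "y \<in> ball x e" using he h by (simp add: dist_norm norm_minus_commute)
        qed
        then show ?thesis using e by blast
      qed
      have "integral (cbox x (x + h *\<^sub>R One)) f = integral (cbox x (x + h *\<^sub>R One)) d"
        by (rule integral_cong) (use sub box_subset_cbox[of p q] in \<open>auto simp: f_def\<close>)
      also have "\<dots> = 0"
        by (rule integral_box_eq_0_if_test_functions[OF d 0])
          (use sub box_subset_cbox[of p q] pq in auto)
      finally show False using \<delta>(2) h fx by force
    qed
    moreover have "negligible (N \<union> (cbox p q - box p q))"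
      using N negligible_frontier_interval by (intro negligible_Un)
    ultimately show ?thesis by (metis negligible_subset)
  qed
  obtain \<D> where \<D>: "countable \<D>" "\<And>X. X \<in> \<D> \<Longrightarrow> \<exists>p q. X = cbox p q" "\<Union>\<D> = S"
    by (rule open_countable_Union_open_cbox[OF S]) blast
  have "negligible {x \<in> X. d x \<noteq> 0}" if "X \<in> \<D>" for X
    using \<D>(2)[OF that] Union_upper[OF that] \<D>(3) * by auto
  then have "negligible (\<Union>X\<in>\<D>. {x \<in> X. d x \<noteq> 0})"
    using \<D>(1) by (intro negligible_countable_Union) auto
  moreover have "(\<Union>X\<in>\<D>. {x \<in> X. d x \<noteq> 0}) = {x. \<not> (x \<in> S \<longrightarrow> d x = 0)}"
    using \<D>(3) by auto
  ultimately have "{x. \<not> (x \<in> S \<longrightarrow> d x = 0)} \<in> null_sets lebesgue"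
    by (simp add: negligible_iff_null_sets)
  then show ?thesis
    by (rule AE_I') simp
qed


section \<open>Integration over sets and compact supports\<close>

text \<open>Completeness of Lebesgue measure. It makes the equality of integrals of almost everywhere equal
  functions unconditional, so that integrals can be compared without first establishing
  measurability of the integrands.\<close>

lemma borel_measurable_lebesgue_AE_cong:
  fixes f g :: "'a::euclidean_space \<Rightarrow> 'b::topological_space"
  assumes "f \<in> borel_measurable lebesgue" "AE x in lebesgue. f x = g x"
  shows "g \<in> borel_measurable lebesgue"
proof (rule measurableI)
  fix A :: "'b set" assume A: "A \<in> sets borel"
  obtain N where "{x. f x \<noteq> g x} \<subseteq> N" "N \<in> null_sets lebesgue"
    using AE_E[OF assms(2)] by (force simp: null_sets_def)
  then have N: "negligible {x. f x \<noteq> g x}"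
    using negligible_subset[of N] by (simp add: negligible_iff_null_sets)
  have "g -` A = (f -` A - {x. f x \<noteq> g x}) \<union> (g -` A \<inter> {x. f x \<noteq> g x})" by auto
  moreover have "f -` A \<in> sets lebesgue"
    using measurable_sets[OF assms(1) A] by simp
  moreover have "{x. f x \<noteq> g x} \<in> sets lebesgue" "g -` A \<inter> {x. f x \<noteq> g x} \<in> sets lebesgue"
    using negligible_imp_sets[OF N] negligible_imp_sets[OF negligible_subset[OF N Int_lower2]] by auto
  ultimately have "g -` A \<in> sets lebesgue"
    by (metis (no_types) sets.Un sets.Diff)
  then show "g -` A \<inter> space lebesgue \<in> sets lebesgue"
    by simp
qed auto

lemma lebesgue_integral_AE_cong:
  fixes f g :: "'a::euclidean_space \<Rightarrow> 'b::euclidean_space"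
  assumes "AE x in lebesgue. f x = g x"
  shows "integrable lebesgue f \<longleftrightarrow> integrable lebesgue g"
    and "integral\<^sup>L lebesgue f = integral\<^sup>L lebesgue g"
proof -
  have sym: "AE x in lebesgue. g x = f x"
    using assms by eventually_elim simp
  have m: "f \<in> borel_measurable lebesgue \<longleftrightarrow> g \<in> borel_measurable lebesgue"
    using borel_measurable_lebesgue_AE_cong[OF _ assms] borel_measurable_lebesgue_AE_cong[OF _ sym]
    by blast
  show i: "integrable lebesgue f \<longleftrightarrow> integrable lebesgue g"
    using integrable_cong_AE[OF _ _ assms] m borel_measurable_integrable[of lebesgue f]
      borel_measurable_integrable[of lebesgue g] by blast
  show "integral\<^sup>L lebesgue f = integral\<^sup>L lebesgue g"
  proof (cases "integrable lebesgue f")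
    case True
    then show ?thesis
      using integral_cong_AE[OF _ _ assms] m borel_measurable_integrable[of lebesgue f] by blast
  next
    case False
    then show ?thesis using i by (simp add: not_integrable_integral_eq)
  qed
qed

lemma set_lebesgue_integral_AE_cong_complete:
  fixes f g :: "'a::euclidean_space \<Rightarrow> 'b::euclidean_space"
  assumes "AE x in lebesgue. x \<in> S \<longrightarrow> f x = g x"
  shows "set_integrable lebesgue S f \<longleftrightarrow> set_integrable lebesgue S g"
    and "(LINT x:S|lebesgue. f x) = (LINT x:S|lebesgue. g x)"
proof -
  have *: "AE x in lebesgue. indicat_real S x *\<^sub>R f x = indicat_real S x *\<^sub>R g x"
    using assms by eventually_elim (auto simp: indicator_def)
  show "set_integrable lebesgue S f \<longleftrightarrow> set_integrable lebesgue S g"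
    "(LINT x:S|lebesgue. f x) = (LINT x:S|lebesgue. g x)"
    using lebesgue_integral_AE_cong[OF *] unfolding set_integrable_def set_lebesgue_integral_def by auto
qed

lemma set_integrable_compact:
  fixes g :: "'a::euclidean_space \<Rightarrow> 'b::euclidean_space"
  assumes "compact K" "continuous_on K g"
  shows "set_integrable lebesgue K g"
  using borel_integrable_compact[OF assms] unfolding set_integrable_def
  by (simp add: integrable_completion borel_measurable_integrable)

lemma set_integrable_supported:
  fixes g :: "'a::euclidean_space \<Rightarrow> 'b::euclidean_space"
  assumes "continuous_on S g" "compact K" "K \<subseteq> S" "\<And>x. x \<in> S \<Longrightarrow> x \<notin> K \<Longrightarrow> g x = 0"
  shows "set_integrable lebesgue S g"
proof -
  have "(\<lambda>x. indicat_real S x *\<^sub>R g x) = (\<lambda>x. indicat_real K x *\<^sub>R g x)"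
    using assms(3,4) by (auto simp: indicator_def fun_eq_iff)
  then show ?thesis
    using set_integrable_compact[OF assms(2) continuous_on_subset[OF assms(1,3)]]
    unfolding set_integrable_def by simp
qed

lemma set_borel_measurable_continuous:
  fixes g :: "'a::euclidean_space \<Rightarrow> 'b::euclidean_space"
  assumes "open S" "continuous_on S g"
  shows "set_borel_measurable lebesgue S g"
  unfolding set_borel_measurable_def
  using borel_measurable_continuous_on_indicator[OF borel_open[OF assms(1)] assms(2)]
  by (intro measurable_completion) simp


section \<open>Test functions\<close>

definition supp :: "('a::topological_space \<Rightarrow> real) \<Rightarrow> 'a set" where
  "supp v = closure {x. v x \<noteq> 0}"

lemma not_in_supp: "x \<notin> supp v \<Longrightarrow> v x = 0"
  using subsetD[OF closure_subset, of x "{x. v x \<noteq> 0}"] by (auto simp: supp_def)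

lemma partial_eq_0_off_supp: "x \<notin> supp v \<Longrightarrow> partial b v x = 0"
proof -
  assume x: "x \<notin> supp v"
  have "partial b v x = partial b (\<lambda>_. 0) x"
  proof (rule partial_cong_open)
    show "open (- supp v)" by (simp add: supp_def open_Compl)
  qed (use x in \<open>auto simp: not_in_supp\<close>)
  then show ?thesis by (simp add: partial_const)
qed

lemma test_functionD:
  assumes "test_function S \<psi>"
  shows "smooth \<psi>" "compact (supp \<psi>)" "supp \<psi> \<subseteq> S"
  using assms unfolding test_function_def supp_def by auto

lemma test_function_partial:
  assumes "test_function S \<psi>" "b \<in> Basis"
  shows "test_function S (partial b \<psi>)"
proof -
  have "closure {x. partial b \<psi> x \<noteq> 0} \<subseteq> supp \<psi>"
    using partial_eq_0_off_supp[of _ \<psi> b] by (intro closure_minimal) (auto simp: supp_def)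
  moreover from this have "compact (closure {x. partial b \<psi> x \<noteq> 0})"
    using bounded_subset[OF compact_imp_bounded[OF test_functionD(2)[OF assms(1)]]]
    by (auto simp: compact_eq_bounded_closed)
  ultimately show ?thesis
    using test_functionD(1,3)[OF assms(1)] smooth_partial[OF _ assms(2)] unfolding test_function_def
    by auto
qed

lemma test_function_bounded:
  assumes "test_function S \<psi>"
  obtains B where "B \<ge> 0" "\<And>x. \<bar>\<psi> x\<bar> \<le> B"
proof -
  have "bounded (\<psi> ` supp \<psi>)"
    using test_functionD[OF assms]
    by (intro compact_imp_bounded compact_continuous_image smooth_continuous_on)
  then obtain B where B: "\<And>y. y \<in> \<psi> ` supp \<psi> \<Longrightarrow> norm y \<le> B"
    unfolding bounded_iff by auto
  have "\<bar>\<psi> x\<bar> \<le> max 0 B" for x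
    using B[of "\<psi> x"] not_in_supp[of x \<psi>] by (cases "x \<in> supp \<psi>") auto
  then show thesis by (intro that[of "max 0 B"]) auto
qed

lemma set_integrable_mult_test_function:
  assumes "locally_integrable_on S d" "test_function S \<psi>"
  shows "set_integrable lebesgue S (\<lambda>x. d x * \<psi> x :: real)"
proof -
  obtain B where B: "B \<ge> 0" "\<And>x. \<bar>\<psi> x\<bar> \<le> B"
    by (rule test_function_bounded[OF assms(2)]) blast
  have d: "set_integrable lebesgue (supp \<psi>) d"
    using assms test_functionD[OF assms(2)] unfolding locally_integrable_on_def by auto
  then have dm: "(\<lambda>x. indicat_real (supp \<psi>) x *\<^sub>R d x) \<in> borel_measurable lebesgue"
    unfolding set_integrable_def by auto
  have pm: "\<psi> \<in> borel_measurable lebesgue"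
    using smooth_continuous_on[OF test_functionD(1)[OF assms(2)]]
    by (intro measurable_completion) (simp add: borel_measurable_continuous_onI)
  have "integrable lebesgue (\<lambda>x. (indicat_real (supp \<psi>) x *\<^sub>R d x) * \<psi> x)"
  proof (rule Bochner_Integration.integrable_bound)
    show "integrable lebesgue (\<lambda>x. (indicat_real (supp \<psi>) x *\<^sub>R d x) * B)"
      using d unfolding set_integrable_def by (rule integrable_mult_left)
    show "(\<lambda>x. (indicat_real (supp \<psi>) x *\<^sub>R d x) * \<psi> x) \<in> borel_measurable lebesgue"
      by (intro borel_measurable_times dm pm)
    show "AE x in lebesgue. norm (indicat_real (supp \<psi>) x *\<^sub>R d x * \<psi> x)
        \<le> norm (indicat_real (supp \<psi>) x *\<^sub>R d x * B)"
      using B by (auto simp: abs_mult intro!: mult_left_mono)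
  qed
  moreover have "(\<lambda>x. (indicat_real (supp \<psi>) x *\<^sub>R d x) * \<psi> x) = (\<lambda>x. indicat_real S x *\<^sub>R (d x * \<psi> x))"
    using test_functionD(3)[OF assms(2)] not_in_supp[of _ \<psi>] by (auto simp: indicator_def fun_eq_iff)
  ultimately show ?thesis unfolding set_integrable_def by simp
qed


section \<open>Integration by parts\<close>

text \<open>Fubini's theorem on a box around the support and the fundamental theorem of calculus in the
  direction \<open>b\<close>.\<close>

lemma integral_partial_eq_0:
  fixes v :: "real \<times> real \<Rightarrow> real"
  assumes diff: "\<And>x. v differentiable (at x)" and b: "b \<in> Basis"
    and cont: "continuous_on UNIV (partial b v)"
    and K: "compact K" "\<And>x. x \<notin> K \<Longrightarrow> v x = 0"
  shows "(LINT x|lebesgue. partial b v x) = 0"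
proof -
  obtain c where c: "K \<subseteq> box (- c) c"
    by (rule bounded_subset_box_symmetric[OF compact_imp_bounded[OF K(1)]])
  obtain p q where pq: "c = (p, q)" by fastforce
  have off: "x \<notin> K" if "fst x \<in> {- p, p} \<or> snd x \<in> {- q, q}" for x
    using subsetD[OF c, of x] that unfolding pq by (cases x) (auto simp: mem_box Basis_prod_def)
  have p0: "partial b v x = 0" if "x \<notin> K" for x
  proof -
    have "partial b v x = partial b (\<lambda>_. 0) x"
      by (rule partial_cong_open[of "- K"]) (use K compact_imp_closed[OF K(1)] that in auto)
    then show ?thesis by (simp add: partial_const)
  qed
  have p0': "partial b v x = 0" if "x \<notin> cbox (- c) c" for x
    by (rule p0) (use c that box_subset_cbox[of "- c" c] in blast)
  have cont': "continuous_on A (partial b v)" for A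
    using cont continuous_on_subset by blast
  have line: "((\<lambda>t. v (z + t *\<^sub>R e)) has_vector_derivative partial e v (z + t *\<^sub>R e)) (at t)" for z e t
    using has_real_derivative_along_line[OF diff] by (simp add: has_real_derivative_iff_has_vector_derivative)
  have "(LINT x|lebesgue. partial b v x) = (LINT x:cbox (- c) c|lebesgue. partial b v x)"
    unfolding set_lebesgue_integral_def
    by (rule Bochner_Integration.integral_cong) (auto simp: p0' indicator_def)
  also have "\<dots> = integral (cbox (- c) c) (partial b v)"
    by (intro set_lebesgue_integral_eq_integral set_integrable_compact cont' compact_cbox)
  also have "\<dots> = integral (cbox (-p) p) (\<lambda>x. integral (cbox (-q) q) (\<lambda>y. partial b v (x, y)))"
    using integral_prod_continuous[of "-p" "-q" p q "partial b v"] cont' by (simp add: pq)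
  also have "\<dots> = 0"
  proof (cases "p < 0 \<or> q < 0")
    case True
    then show ?thesis by auto
  next
    case False
    then have pq0: "- p \<le> p" "- q \<le> q" by auto
    have "b = (1, 0) \<or> b = (0, 1)" using b by (auto simp: Basis_prod_def)
    then show ?thesis
    proof
      assume b: "b = (0, 1)"
      have "((\<lambda>y. partial b v (x, y)) has_integral (v (x, q) - v (x, - q))) {-q..q}" for x
      proof (rule fundamental_theorem_of_calculus[OF pq0(2)])
        show "((\<lambda>y. v (x, y)) has_vector_derivative partial b v (x, y)) (at y within {-q..q})" for y
          using line[of "(x, 0)" b y] unfolding b by (simp add: has_vector_derivative_at_within)
      qed
      moreover have "v (x, q) = 0" "v (x, - q) = 0" for x
        by (auto intro!: K(2) off)
      ultimately have "integral (cbox (-q) q) (\<lambda>y. partial b v (x, y)) = 0" for x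
        by (metis cbox_interval diff_zero integral_unique)
      then show ?thesis by simp
    next
      assume b: "b = (1, 0)"
      have "((\<lambda>x. partial b v (x, y)) has_integral (v (p, y) - v (- p, y))) {-p..p}" for y
      proof (rule fundamental_theorem_of_calculus[OF pq0(1)])
        show "((\<lambda>x. v (x, y)) has_vector_derivative partial b v (x, y)) (at x within {-p..p})" for x
          using line[of "(0, y)" b x] unfolding b by (simp add: has_vector_derivative_at_within)
      qed
      moreover have "v (p, y) = 0" "v (- p, y) = 0" for y
        by (auto intro!: K(2) off)
      ultimately have "integral (cbox (-p) p) (\<lambda>x. partial b v (x, y)) = 0" for y
        by (metis cbox_interval diff_zero integral_unique)
      then show ?thesis
        by (subst integral_swap_continuous) (auto intro: cont')
    qed
  qed
  finally show ?thesis .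
qed

lemma differentiable_transform_open:
  assumes "v differentiable (at x)" "open S" "x \<in> S" "\<And>y. y \<in> S \<Longrightarrow> v y = w y"
  shows "w differentiable (at x)"
  using assms has_derivative_transform_within_open[OF _ assms(2,3), of v _ UNIV w]
  unfolding differentiable_def by blast

text \<open>The product \<open>v \<psi>\<close>, extended by zero, is differentiable with continuous partial derivatives on the
  whole plane, because \<open>S\<close> and the complement of the support of \<open>\<psi>\<close> cover it.\<close>

lemma integration_by_parts:
  fixes v :: "real \<times> real \<Rightarrow> real"
  assumes S: "open S" and diff: "\<And>x. x \<in> S \<Longrightarrow> v differentiable (at x)"
    and b: "b \<in> Basis" and cont: "continuous_on S (partial b v)" and \<psi>: "test_function S \<psi>"
  shows "(LINT x:S|lebesgue. v x * partial b \<psi> x) = - (LINT x:S|lebesgue. partial b v x * \<psi> x)"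
proof -
  note \<psi>' = test_functionD[OF \<psi>]
  define w where "w x = (if x \<in> S then v x * \<psi> x else 0)" for x
  have off: "w x = 0" if "x \<notin> supp \<psi>" for x
    using that by (simp add: w_def not_in_supp)
  have ocomp: "open (- supp \<psi>)" by (simp add: supp_def open_Compl)
  have cases: "x \<in> S \<or> x \<in> - supp \<psi>" for x using \<psi>'(3) by auto
  have diffw: "w differentiable (at x)" for x
  proof (cases "x \<in> S")
    case True
    have "(\<lambda>x. v x * \<psi> x) differentiable (at x)"
      using diff[OF True] smooth_differentiable[OF \<psi>'(1)] by (rule differentiable_mult)
    then show ?thesis
      using differentiable_transform_open[OF _ S True, of "\<lambda>x. v x * \<psi> x" w]
      by (auto simp: w_def)
  next
    case False
    then have "x \<in> - supp \<psi>" using cases by blast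
    then show ?thesis
      using differentiable_transform_open[OF _ ocomp, of "\<lambda>x. 0" x w] off by auto
  qed
  have pw: "partial b w x = partial b v x * \<psi> x + v x * partial b \<psi> x" if "x \<in> S" for x
  proof -
    have "partial b w x = partial b (\<lambda>x. v x * \<psi> x) x"
      by (rule partial_cong_open[OF S that]) (simp add: w_def)
    then show ?thesis
      by (simp add: partial_mult[OF diff[OF that] smooth_differentiable[OF \<psi>'(1)]])
  qed
  have pw0: "partial b w x = 0" if "x \<notin> supp \<psi>" for x
    using partial_cong_open[OF ocomp, of x w "\<lambda>_. 0"] partial_const[of b 0 x] off that by auto
  have contv: "continuous_on S v"
    using diff by (auto simp: continuous_on_eq_continuous_within
        intro!: continuous_at_imp_continuous_at_within[OF differentiable_imp_continuous_within])
  have c1: "continuous_on S (\<lambda>x. partial b v x * \<psi> x)"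
    by (intro continuous_intros cont smooth_continuous_on \<psi>')
  have c2: "continuous_on S (\<lambda>x. v x * partial b \<psi> x)"
    by (intro continuous_intros contv smooth_continuous_on smooth_partial \<psi>' b)
  have "continuous_on (S \<union> - supp \<psi>) (partial b w)"
  proof (rule continuous_on_open_Un[OF S ocomp])
    show "continuous_on S (partial b w)"
      using continuous_on_add[OF c1 c2] by (rule continuous_on_eq) (simp add: pw)
    show "continuous_on (- supp \<psi>) (partial b w)"
      by (rule continuous_on_eq[of _ "\<lambda>_. 0"]) (auto simp: pw0)
  qed
  then have "continuous_on UNIV (partial b w)"
    using cases UNIV_eq_I[of "S \<union> - supp \<psi>"] by simp
  then have "(LINT x|lebesgue. partial b w x) = 0"
    using integral_partial_eq_0[OF diffw b _ \<psi>'(2)] off by auto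
  moreover have "(LINT x|lebesgue. partial b w x) =
      (LINT x:S|lebesgue. partial b v x * \<psi> x + v x * partial b \<psi> x)"
    unfolding set_lebesgue_integral_def
  proof (rule Bochner_Integration.integral_cong[OF refl])
    show "partial b w x = indicat_real S x *\<^sub>R (partial b v x * \<psi> x + v x * partial b \<psi> x)" for x
      using cases[of x] pw[of x] pw0[of x] by (cases "x \<in> S") auto
  qed
  moreover have "\<dots> = (LINT x:S|lebesgue. partial b v x * \<psi> x) + (LINT x:S|lebesgue. v x * partial b \<psi> x)"
    by (intro set_integral_add set_integrable_supported[OF c1 \<psi>'(2,3)] set_integrable_supported[OF c2 \<psi>'(2,3)])
      (auto simp: not_in_supp partial_eq_0_off_supp)
  ultimately show ?thesis by simp
qed


section \<open>Weak gradients\<close>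

lemma gradient_inner: "b \<in> Basis \<Longrightarrow> gradient v x \<bullet> b = partial b v x"
  by (simp only: gradient_def inner_sum_left_Basis)

lemma continuous_on_gradient:
  "Ck 1 S v \<Longrightarrow> continuous_on S (gradient v)"
  unfolding gradient_def[abs_def]
  by (intro continuous_on_sum continuous_on_scaleR continuous_on_const) simp

lemma locally_integrable_continuous:
  assumes "continuous_on S g"
  shows "locally_integrable_on S g"
  unfolding locally_integrable_on_def
proof (intro allI impI)
  fix K assume K: "compact K \<and> K \<subseteq> S"
  show "set_integrable lebesgue K g"
    by (rule set_integrable_compact) (use K continuous_on_subset[OF assms] in simp_all)
qed

lemma locally_integrable_add_scaleR:
  "locally_integrable_on S g \<Longrightarrow> locally_integrable_on S g' \<Longrightarrow>
    locally_integrable_on S (\<lambda>x. g x + t *\<^sub>R g' x)"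
  unfolding locally_integrable_on_def
  by (intro allI impI set_integral_add set_integrable_scaleR_right) simp_all

lemma locally_integrable_inner:
  assumes "locally_integrable_on S g"
  shows "locally_integrable_on S (\<lambda>x. g x \<bullet> b)"
proof -
  have "set_integrable lebesgue K (\<lambda>x. g x \<bullet> b)" if "set_integrable lebesgue K g" for K
    using integrable_inner_left[of b lebesgue "\<lambda>x. indicator K x *\<^sub>R g x"] that
    unfolding set_integrable_def by simp
  then show ?thesis using assms unfolding locally_integrable_on_def by auto
qed

lemma has_weak_gradient_C1:
  fixes v :: "real \<times> real \<Rightarrow> real"
  assumes "open S" "Ck 1 S v"
  shows "has_weak_gradient S v (gradient v)"
  unfolding has_weak_gradient_def
proof (intro conjI allI impI ballI)
  show "locally_integrable_on S v" "locally_integrable_on S (gradient v)"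
    using Ck_SucD[of 0 S v] assms(2)
    by (simp_all add: locally_integrable_continuous continuous_on_gradient[OF assms(2)])
  fix \<psi> and b :: "real \<times> real" assume "test_function S \<psi>" and b: "b \<in> Basis"
  then have "(LINT x:S|lebesgue. v x * partial b \<psi> x) = - (LINT x:S|lebesgue. partial b v x * \<psi> x)"
    using assms(2) by (intro integration_by_parts[OF assms(1)]) auto
  then show "(LINT x:S|lebesgue. v x * partial b \<psi> x) = - (LINT x:S|lebesgue. gradient v x \<bullet> b * \<psi> x)"
    by (simp only: gradient_inner[OF b])
qed

lemma has_weak_gradient_add:
  assumes u: "has_weak_gradient S u g" and w: "has_weak_gradient S w g'"
  shows "has_weak_gradient S (\<lambda>x. u x + t * w x) (\<lambda>x. g x + t *\<^sub>R g' x)"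
  unfolding has_weak_gradient_def
proof (intro conjI allI impI ballI)
  note u' = u[unfolded has_weak_gradient_def] and w' = w[unfolded has_weak_gradient_def]
  show "locally_integrable_on S (\<lambda>x. g x + t *\<^sub>R g' x)" "locally_integrable_on S (\<lambda>x. u x + t * w x)"
    using u' w' locally_integrable_add_scaleR[of S g g' t] locally_integrable_add_scaleR[of S u w t] by auto
  fix \<psi> b assume \<psi>: "test_function S \<psi>" and b: "b \<in> (Basis :: 'a set)"
  note int = set_integrable_mult_test_function[OF _ \<psi>] set_integrable_mult_test_function[OF _ test_function_partial[OF \<psi> b]]
  have "(LINT x:S|lebesgue. (u x + t * w x) * partial b \<psi> x) =
      (LINT x:S|lebesgue. u x * partial b \<psi> x + t * (w x * partial b \<psi> x))"
    by (simp add: algebra_simps)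
  also have "\<dots> = (LINT x:S|lebesgue. u x * partial b \<psi> x) + t * (LINT x:S|lebesgue. w x * partial b \<psi> x)"
    using u' w' by (subst set_integral_add) (auto intro!: int)
  also have "\<dots> = - ((LINT x:S|lebesgue. (g x \<bullet> b) * \<psi> x) + t * (LINT x:S|lebesgue. (g' x \<bullet> b) * \<psi> x))"
    using u' w' \<psi> b by simp
  also have "\<dots> = - (LINT x:S|lebesgue. (g x \<bullet> b) * \<psi> x + t * ((g' x \<bullet> b) * \<psi> x))"
    using u' w' by (subst set_integral_add) (auto intro!: int locally_integrable_inner)
  finally show "(LINT x:S|lebesgue. (u x + t * w x) * partial b \<psi> x) =
      - (LINT x:S|lebesgue. ((g x + t *\<^sub>R g' x) \<bullet> b) * \<psi> x)"
    by (simp add: algebra_simps inner_add_left)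
qed

lemma weak_gradient_AE_unique:
  assumes S: "open S" and g: "has_weak_gradient S u g" and g': "has_weak_gradient S u g'"
  shows "AE x in lebesgue. x \<in> S \<longrightarrow> g x = g' x"
proof -
  note g1 = g[unfolded has_weak_gradient_def] and g2 = g'[unfolded has_weak_gradient_def]
  have "AE x in lebesgue. x \<in> S \<longrightarrow> (g x + (-1) *\<^sub>R g' x) \<bullet> b = 0" if b: "b \<in> Basis" for b
  proof (rule fundamental_lemma[OF S])
    show "locally_integrable_on S (\<lambda>x. (g x + (-1) *\<^sub>R g' x) \<bullet> b)"
      using g1 g2 by (intro locally_integrable_inner locally_integrable_add_scaleR) auto
    fix \<psi> assume \<psi>: "test_function S \<psi>"
    have "(LINT x:S|lebesgue. (g x \<bullet> b) * \<psi> x - (g' x \<bullet> b) * \<psi> x) =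
        (LINT x:S|lebesgue. (g x \<bullet> b) * \<psi> x) - (LINT x:S|lebesgue. (g' x \<bullet> b) * \<psi> x)"
      using g1 g2 \<psi>
      by (intro set_integral_diff) (auto intro!: set_integrable_mult_test_function locally_integrable_inner)
    also have "\<dots> = 0"
    proof -
      have "(LINT x:S|lebesgue. u x * partial b \<psi> x) = - (LINT x:S|lebesgue. (g x \<bullet> b) * \<psi> x)"
        "(LINT x:S|lebesgue. u x * partial b \<psi> x) = - (LINT x:S|lebesgue. (g' x \<bullet> b) * \<psi> x)"
        using g1 g2 \<psi> b by blast+
      then show ?thesis by linarith
    qed
    finally show "(LINT x:S|lebesgue. ((g x + (-1) *\<^sub>R g' x) \<bullet> b) * \<psi> x) = 0"
      by (simp add: algebra_simps inner_diff_left)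
  qed
  then have "AE x in lebesgue. \<forall>b\<in>Basis. x \<in> S \<longrightarrow> (g x + (-1) *\<^sub>R g' x) \<bullet> b = 0"
    by (intro AE_finite_allI) auto
  then show ?thesis
  proof eventually_elim
    case (elim x)
    then show ?case
      using euclidean_eqI[of "g x" "g' x"] by (simp add: inner_diff_left)
  qed
qed

lemma weak_gradient_AE_eq:
  assumes "open S" "has_weak_gradient S u g"
  shows "AE x in lebesgue. x \<in> S \<longrightarrow> weak_gradient S u x = g x"
proof (rule weak_gradient_AE_unique[OF assms(1) _ assms(2)])
  show "has_weak_gradient S u (weak_gradient S u)"
    unfolding weak_gradient_def by (rule someI[where P = "has_weak_gradient S u", OF assms(2)])
qed

lemma L2_on_add:
  fixes u w :: "'a::euclidean_space \<Rightarrow> 'b::euclidean_space"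
  assumes "L2_on S u" "L2_on S w"
  shows "L2_on S (\<lambda>x. u x + t *\<^sub>R w x)"
proof -
  note u = assms(1)[unfolded L2_on_def] and w = assms(2)[unfolded L2_on_def]
  have "(\<lambda>x. indicat_real S x *\<^sub>R u x + t *\<^sub>R (indicat_real S x *\<^sub>R w x)) \<in> borel_measurable lebesgue"
    using u w unfolding set_borel_measurable_def
    by (intro borel_measurable_add borel_measurable_scaleR[OF borel_measurable_const]) auto
  then have m: "(\<lambda>x. indicat_real S x *\<^sub>R (u x + t *\<^sub>R w x)) \<in> borel_measurable lebesgue"
    by (simp add: algebra_simps)
  then have "(\<lambda>x. (norm (indicat_real S x *\<^sub>R (u x + t *\<^sub>R w x)))\<^sup>2) \<in> borel_measurable lebesgue"
    by measurable
  moreover have "(\<lambda>x. (norm (indicat_real S x *\<^sub>R (u x + t *\<^sub>R w x)))\<^sup>2) =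
      (\<lambda>x. indicat_real S x *\<^sub>R (norm (u x + t *\<^sub>R w x))\<^sup>2)"
    by (auto simp: indicator_def fun_eq_iff)
  ultimately have m2: "set_borel_measurable lebesgue S (\<lambda>x. (norm (u x + t *\<^sub>R w x))\<^sup>2)"
    unfolding set_borel_measurable_def by simp
  have le: "(norm (p + t *\<^sub>R q))\<^sup>2 \<le> 2 * (norm p)\<^sup>2 + 2 * t\<^sup>2 * (norm q)\<^sup>2" for p q :: 'b
  proof -
    have "(norm (p + t *\<^sub>R q))\<^sup>2 \<le> (norm p + norm (t *\<^sub>R q))\<^sup>2"
      by (intro power_mono norm_triangle_ineq) auto
    also have "\<dots> \<le> 2 * (norm p)\<^sup>2 + 2 * (norm (t *\<^sub>R q))\<^sup>2"
      using sum_squares_bound[of "norm p" "norm (t *\<^sub>R q)"] by (simp add: power2_sum)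
    finally show ?thesis by (simp add: power_mult_distrib)
  qed
  have "set_integrable lebesgue S (\<lambda>x. (norm (u x + t *\<^sub>R w x))\<^sup>2)"
  proof (rule set_integrable_bound[OF _ m2])
    show "set_integrable lebesgue S (\<lambda>x. 2 * (norm (u x))\<^sup>2 + 2 * t\<^sup>2 * (norm (w x))\<^sup>2)"
      using u w by (intro set_integral_add set_integrable_mult_right) auto
    show "AE x in lebesgue. x \<in> S \<longrightarrow> norm ((norm (u x + t *\<^sub>R w x))\<^sup>2)
        \<le> norm (2 * (norm (u x))\<^sup>2 + 2 * t\<^sup>2 * (norm (w x))\<^sup>2)"
      using le by (auto simp: abs_of_nonneg)
  qed
  then show ?thesis unfolding L2_on_def set_borel_measurable_def using m by simp
qed

lemma L2_on_supported:
  fixes g :: "'a::euclidean_space \<Rightarrow> 'b::euclidean_space"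
  assumes "open S" "continuous_on S g" "compact K" "K \<subseteq> S" "\<And>x. x \<in> S \<Longrightarrow> x \<notin> K \<Longrightarrow> g x = 0"
  shows "L2_on S g"
  unfolding L2_on_def
proof
  show "set_borel_measurable lebesgue S g"
    using assms by (intro set_borel_measurable_continuous)
  show "set_integrable lebesgue S (\<lambda>x. (norm (g x))\<^sup>2)"
    using assms by (intro set_integrable_supported[of S _ K] continuous_intros) auto
qed

lemma L2_on_AE_cong:
  fixes g g' :: "'a::euclidean_space \<Rightarrow> 'b::euclidean_space"
  assumes "AE x in lebesgue. x \<in> S \<longrightarrow> g x = g' x" "L2_on S g"
  shows "L2_on S g'"
proof -
  have "AE x in lebesgue. indicat_real S x *\<^sub>R g x = indicat_real S x *\<^sub>R g' x"
    using assms(1) by eventually_elim (auto simp: indicator_def)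
  then have 1: "set_borel_measurable lebesgue S g'"
    using assms(2) unfolding L2_on_def set_borel_measurable_def
    by (auto intro: borel_measurable_lebesgue_AE_cong)
  have "AE x in lebesgue. x \<in> S \<longrightarrow> (norm (g x))\<^sup>2 = (norm (g' x))\<^sup>2"
    using assms(1) by eventually_elim auto
  then have "set_integrable lebesgue S (\<lambda>x. (norm (g' x))\<^sup>2)"
    using assms(2) set_lebesgue_integral_AE_cong_complete(1)[of S "\<lambda>x. (norm (g x))\<^sup>2"]
    by (simp add: L2_on_def)
  then show ?thesis
    using 1 by (simp add: L2_on_def)
qed

lemma test_function_C1: "test_function S \<psi> \<Longrightarrow> Ck 1 A \<psi>"
  using smooth_differentiable test_functionD(1)[of S \<psi>]
  by (auto intro!: smooth_continuous_on smooth_partial)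

lemma gradient_eq_0_off_supp: "x \<notin> supp v \<Longrightarrow> gradient v x = 0"
  by (simp add: gradient_def partial_eq_0_off_supp)

text \<open>The chosen weak gradient of the perturbed function can differ from the expected one, but by
  uniqueness only on a null set.\<close>

lemma W12_add_test_function:
  fixes u :: "real \<times> real \<Rightarrow> real"
  assumes S: "open S" and u: "u \<in> W12 S" and \<psi>: "test_function S \<psi>"
  shows "(\<lambda>x. u x + t * \<psi> x) \<in> W12 S"
    and "AE x in lebesgue. x \<in> S \<longrightarrow>
      weak_gradient S (\<lambda>x. u x + t * \<psi> x) x = weak_gradient S u x + t *\<^sub>R gradient \<psi> x"
proof -
  note \<psi>' = test_functionD[OF \<psi>]
  obtain g where u2: "L2_on S u" and g: "has_weak_gradient S u g" and g2: "L2_on S g"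
    using u unfolding W12_def by auto
  have wg: "has_weak_gradient S (\<lambda>x. u x + t * \<psi> x) (\<lambda>x. g x + t *\<^sub>R gradient \<psi> x)"
    by (intro has_weak_gradient_add g has_weak_gradient_C1 S test_function_C1[OF \<psi>])
  have "L2_on S \<psi>"
    by (rule L2_on_supported[OF S _ \<psi>'(2,3)]) (auto simp: not_in_supp smooth_continuous_on \<psi>')
  moreover have "L2_on S (gradient \<psi>)"
    by (rule L2_on_supported[OF S _ \<psi>'(2,3)])
      (auto simp: gradient_eq_0_off_supp intro: continuous_on_gradient test_function_C1 \<psi>)
  ultimately show "(\<lambda>x. u x + t * \<psi> x) \<in> W12 S"
    using wg L2_on_add[OF u2, of \<psi> t] L2_on_add[OF g2, of "gradient \<psi>" t] unfolding W12_def by auto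
  show "AE x in lebesgue. x \<in> S \<longrightarrow>
      weak_gradient S (\<lambda>x. u x + t * \<psi> x) x = weak_gradient S u x + t *\<^sub>R gradient \<psi> x"
    using weak_gradient_AE_eq[OF S wg] weak_gradient_AE_eq[OF S g] by eventually_elim auto
qed

lemma W12_weak_gradient_L2:
  assumes "open S" "u \<in> W12 S"
  shows "L2_on S (weak_gradient S u)"
proof -
  obtain g where g: "has_weak_gradient S u g" and g2: "L2_on S g"
    using assms(2) unfolding W12_def by auto
  have "AE x in lebesgue. x \<in> S \<longrightarrow> g x = weak_gradient S u x"
    using weak_gradient_AE_eq[OF assms(1) g] by eventually_elim auto
  then show ?thesis using g2 by (rule L2_on_AE_cong)
qed


section \<open>Reaction terms and their potentials\<close>

text \<open>The common content of the two admissible kinds of dynamics, together with monotonicity in the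
  state: \<open>B\<close> bounds the value at state zero and \<open>L\<close> is a Lipschitz constant, one of the two being zero
  for each kind.\<close>

definition regular_dynamics ::
    "'a::topological_space set \<Rightarrow> real \<Rightarrow> real \<Rightarrow> ('a \<Rightarrow> real \<Rightarrow> real) \<Rightarrow> bool" where
  "regular_dynamics S B L f \<longleftrightarrow> 0 \<le> B \<and> 0 \<le> L \<and>
     (\<forall>x\<in>S. 0 \<le> f x 0 \<and> f x 0 \<le> B) \<and>
     (\<forall>x\<in>S. \<forall>s\<ge>0. \<forall>t\<ge>0. \<bar>f x s - f x t\<bar> \<le> L * \<bar>s - t\<bar>) \<and>
     (\<forall>s\<ge>0. continuous_on S (\<lambda>x. f x s)) \<and>
     (\<forall>x\<in>S. mono_on {0..} (f x))"

lemma bounded_square: "bounded (square a)"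
  unfolding square_def by (intro bounded_Times) auto

lemma open_square: "open (square a)"
  unfolding square_def by (intro open_Times) auto

lemma admissible_dynamics_regular:
  assumes f: "admissible_dynamics a m f" and l: "l \<in> {1..m}"
    and mono: "\<forall>z\<in>square a. mono_on {0..} (f l z)"
  obtains B L where "regular_dynamics (square a) B L (f l)"
proof -
  consider "dynamics_state_dependent a (f l)" | "dynamics_state_independent a (f l)"
    using f l unfolding admissible_dynamics_def by auto
  then show thesis
  proof cases
    case 1
    then obtain L where L: "\<forall>x\<in>square a. L-lipschitz_on {0..} (f l x)"
      unfolding dynamics_state_dependent_def by auto
    have lip: "\<bar>f l x s - f l x t\<bar> \<le> max 0 L * \<bar>s - t\<bar>" if "x \<in> square a" "0 \<le> s" "0 \<le> t" for x s t
    proof -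
      have "\<bar>f l x s - f l x t\<bar> \<le> L * \<bar>s - t\<bar>"
        using lipschitz_onD[of L "{0..}" "f l x" s t] L that by (simp add: dist_real_def)
      also have "\<dots> \<le> max 0 L * \<bar>s - t\<bar>" by (intro mult_right_mono) auto
      finally show ?thesis .
    qed
    have "regular_dynamics (square a) 0 (max 0 L) (f l)"
      unfolding regular_dynamics_def
    proof (intro conjI ballI allI impI)
      fix x assume x: "x \<in> square a"
      have "f l x 0 = 0" using 1 x unfolding dynamics_state_dependent_def by blast
      then show "0 \<le> f l x 0" "f l x 0 \<le> 0" by linarith+
      show "mono_on {0..} (f l x)" using mono x by blast
      show "\<bar>f l x s - f l x t\<bar> \<le> max 0 L * \<bar>s - t\<bar>" if "0 \<le> s" "0 \<le> t" for s t
        using lip[OF x that] .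
    next
      show "continuous_on (square a) (\<lambda>x. f l x s)" if "0 \<le> s" for s
      proof -
        have "uniformly_continuous_on (square a) (\<lambda>x. f l x s)"
          using 1 that unfolding dynamics_state_dependent_def by blast
        then show ?thesis by (rule uniformly_continuous_imp_continuous)
      qed
    qed simp_all
    then show thesis by (rule that)
  next
    case 2
    then obtain g where g: "\<forall>x\<in>square a. \<forall>s\<ge>0. f l x s = g x" "\<forall>x\<in>square a. 0 \<le> g x"
      "uniformly_continuous_on (square a) g"
      unfolding dynamics_state_independent_def by auto
    then have "bounded (g ` square a)"
      by (intro bounded_uniformly_continuous_image bounded_square)
    then obtain B where B: "0 < B" "\<And>y. y \<in> g ` square a \<Longrightarrow> \<bar>y\<bar> \<le> B"
      unfolding bounded_pos by auto
    have "g x \<le> B" if "x \<in> square a" for x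
      using B(2)[of "g x"] that by auto
    moreover have "continuous_on (square a) (\<lambda>x. f l x s)" if "0 \<le> s" for s
      using uniformly_continuous_imp_continuous[OF g(3)] by (rule continuous_on_eq) (use g that in auto)
    ultimately have "regular_dynamics (square a) B 0 (f l)"
      unfolding regular_dynamics_def using g B(1) mono by simp
    then show thesis by (rule that)
  qed
qed

lemma regular_dynamicsD:
  assumes "regular_dynamics S B L f"
  shows "0 \<le> B" "0 \<le> L" "\<And>x. x \<in> S \<Longrightarrow> 0 \<le> f x 0" "\<And>x. x \<in> S \<Longrightarrow> f x 0 \<le> B"
    "\<And>x s t. x \<in> S \<Longrightarrow> 0 \<le> s \<Longrightarrow> 0 \<le> t \<Longrightarrow> \<bar>f x s - f x t\<bar> \<le> L * \<bar>s - t\<bar>"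
    "\<And>s. 0 \<le> s \<Longrightarrow> continuous_on S (\<lambda>x. f x s)"
    "\<And>x. x \<in> S \<Longrightarrow> mono_on {0..} (f x)"
  using assms unfolding regular_dynamics_def by simp_all

lemma regular_dynamics_bounds:
  assumes f: "regular_dynamics S B L f" and "x \<in> S" "0 \<le> s"
  shows "0 \<le> f x s" "f x s \<le> B + L * s"
proof -
  have "f x 0 \<le> f x s"
    using mono_onD[OF regular_dynamicsD(7)[OF f assms(2)], of 0 s] assms(3) by simp
  then show "0 \<le> f x s" using regular_dynamicsD(3)[OF f assms(2)] by linarith
  show "f x s \<le> B + L * s"
    using regular_dynamicsD(5)[OF f assms(2,3), of 0] regular_dynamicsD(4)[OF f assms(2)] assms(3)
    by (simp add: abs_le_iff)
qed

lemma regular_dynamics_continuous: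
  assumes f: "regular_dynamics S B L f" and "x \<in> S"
  shows "continuous_on {0..} (f x)"
proof -
  have "L-lipschitz_on {0..} (f x)"
    using regular_dynamicsD(2,5)[OF f] assms(2) by (intro lipschitz_onI) (auto simp: dist_real_def)
  then show ?thesis by (rule lipschitz_on_continuous_on)
qed

text \<open>A monotone reaction term has a convex potential, so the potential lies above its tangents. The
  nonnegativity, growth and variation of the potential are all estimated by this.\<close>

lemma potential_diff_le:
  assumes f: "regular_dynamics S B L f" and x: "x \<in> S" and s: "0 \<le> s" and t: "0 \<le> t"
  shows "potential f x t - potential f x s \<le> (t - s) * f x t"
proof -
  have int: "f x integrable_on {c..d}" if "0 \<le> c" for c d
    using that continuous_on_subset[OF regular_dynamics_continuous[OF f x], of "{c..d}"]
    by (intro integrable_continuous_real) auto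
  have mono: "f x c \<le> f x d" if "0 \<le> c" "c \<le> d" for c d
    using mono_onD[OF regular_dynamicsD(7)[OF f x], of c d] that by simp
  show ?thesis
  proof (cases "s \<le> t")
    case True
    have "potential f x t - potential f x s = integral {s..t} (f x)"
      using Henstock_Kurzweil_Integration.integral_combine[OF s True int] s t
      by (simp add: potential_def)
    also have "\<dots> \<le> integral {s..t} (\<lambda>_. f x t)"
      using s by (intro integral_le int) (auto intro: mono)
    also have "\<dots> = (t - s) * f x t" using True by simp
    finally show ?thesis .
  next
    case False
    then have ts: "t \<le> s" by simp
    have "(s - t) * f x t = integral {t..s} (\<lambda>_. f x t)" using ts by simp
    also have "\<dots> \<le> integral {t..s} (f x)"
      using t by (intro integral_le int) (auto intro: mono)
    also have "\<dots> = potential f x s - potential f x t"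
      using Henstock_Kurzweil_Integration.integral_combine[OF t ts int] s t
      by (simp add: potential_def)
    finally show ?thesis by (simp add: algebra_simps)
  qed
qed

lemma potential_bounds:
  assumes f: "regular_dynamics S B L f" and x: "x \<in> S" and s: "0 \<le> s"
  shows "0 \<le> potential f x s" "potential f x s \<le> s * (B + L * s)"
proof -
  have 0: "potential f x 0 = 0" by (simp add: potential_def)
  have "0 \<le> s * f x 0"
    using regular_dynamicsD(3)[OF f x] s by simp
  then show "0 \<le> potential f x s"
    using potential_diff_le[OF f x s order_refl] 0 by simp
  have "potential f x s \<le> s * f x s"
    using potential_diff_le[OF f x order_refl s] 0 by simp
  also have "\<dots> \<le> s * (B + L * s)"
    using regular_dynamics_bounds[OF f x s] s by (intro mult_left_mono) auto
  finally show "potential f x s \<le> s * (B + L * s)" .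
qed

lemma potential_locally_lipschitz:
  assumes f: "regular_dynamics S B L f" and x: "x \<in> S" and s: "0 \<le> s" and t: "0 \<le> t"
  shows "\<bar>potential f x s - potential f x t\<bar> \<le> (B + L * (s + t)) * \<bar>s - t\<bar>"
proof -
  have *: "(r - q) * f x r \<le> (B + L * (r + q)) * \<bar>r - q\<bar>" if "0 \<le> r" "0 \<le> q" for r q
  proof -
    have "(r - q) * f x r \<le> \<bar>r - q\<bar> * f x r"
      using regular_dynamics_bounds(1)[OF f x that(1)] by (intro mult_right_mono) auto
    also have "\<dots> \<le> \<bar>r - q\<bar> * (B + L * (r + q))"
      using regular_dynamics_bounds(2)[OF f x that(1)] mult_nonneg_nonneg[OF regular_dynamicsD(2)[OF f] that(2)]
      by (intro mult_left_mono) (simp_all add: distrib_left)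
    finally show ?thesis by (simp add: mult.commute)
  qed
  show ?thesis
    using potential_diff_le[OF f x s t] potential_diff_le[OF f x t s] *[OF s t] *[OF t s]
    by (simp add: abs_le_iff add.commute[of t s] abs_minus_commute[of t s])
qed

text \<open>A Lipschitz bound in the state that is uniform in the point upgrades continuity at frozen states
  to continuity along the graph of \<open>u\<close>. The growing Lipschitz constant accommodates the potential, the
  constant one the reaction term itself.\<close>

lemma continuous_on_substitute:
  fixes F :: "'a::topological_space \<Rightarrow> real \<Rightarrow> real" and u :: "'a \<Rightarrow> real"
  assumes F: "\<And>s. 0 \<le> s \<Longrightarrow> continuous_on S (\<lambda>x. F x s)"
    and lip: "\<And>x s t. x \<in> S \<Longrightarrow> 0 \<le> s \<Longrightarrow> 0 \<le> t \<Longrightarrow> \<bar>F x s - F x t\<bar> \<le> (B + L * (s + t)) * \<bar>s - t\<bar>"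
    and u: "continuous_on S u" "\<And>x. x \<in> S \<Longrightarrow> 0 \<le> u x"
  shows "continuous_on S (\<lambda>x. F x (u x))"
  unfolding continuous_on_def
proof
  fix x assume x: "x \<in> S"
  have ut: "(u \<longlongrightarrow> u x) (at x within S)"
    using u(1) x unfolding continuous_on_def by auto
  have "((\<lambda>y. (B + L * (u y + u x)) * \<bar>u y - u x\<bar>) \<longlongrightarrow> (B + L * (u x + u x)) * \<bar>u x - u x\<bar>) (at x within S)"
    by (intro tendsto_intros ut)
  then have z: "((\<lambda>y. (B + L * (u y + u x)) * \<bar>u y - u x\<bar>) \<longlongrightarrow> 0) (at x within S)" by simp
  have "((\<lambda>y. F y (u y) - F y (u x)) \<longlongrightarrow> 0) (at x within S)"
    by (rule Lim_null_comparison[OF _ z])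
      (auto simp: eventually_at_filter intro!: lip u(2) x always_eventually)
  moreover have "((\<lambda>y. F y (u x)) \<longlongrightarrow> F x (u x)) (at x within S)"
    using F[OF u(2)[OF x]] x unfolding continuous_on_def by auto
  ultimately have "((\<lambda>y. (F y (u y) - F y (u x)) + F y (u x)) \<longlongrightarrow> 0 + F x (u x)) (at x within S)"
    by (rule tendsto_add)
  then show "((\<lambda>y. F y (u y)) \<longlongrightarrow> F x (u x)) (at x within S)" by simp
qed

lemma continuous_on_dynamics:
  assumes f: "regular_dynamics S B L f" and u: "continuous_on S u" "\<And>x. x \<in> S \<Longrightarrow> 0 \<le> u x"
  shows "continuous_on S (\<lambda>x. f x (u x))"
  by (rule continuous_on_substitute[where B = L and L = 0])
    (use regular_dynamicsD[OF f] u in auto)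

lemma continuous_on_potential:
  fixes u :: "real \<times> real \<Rightarrow> real"
  assumes f: "regular_dynamics S B L f" and u: "continuous_on S u" "\<And>x. x \<in> S \<Longrightarrow> 0 \<le> u x"
  shows "continuous_on S (\<lambda>x. potential f x (u x))"
proof (rule continuous_on_substitute[OF _ potential_locally_lipschitz[OF f] u])
  fix s :: real assume s: "0 \<le> s"
  have "regular_dynamics (S \<times> {0..s}) B L (\<lambda>z. f (fst z))"
    using f unfolding regular_dynamics_def
    by (auto intro!: continuous_on_compose2[of S _ _ fst] continuous_intros)
  then have "continuous_on (S \<times> {0..s}) (\<lambda>z. f (fst z) (snd z))"
    by (rule continuous_on_dynamics) (auto intro!: continuous_intros)
  then have "continuous_on (S \<times> cbox 0 s) (\<lambda>(x, v). f x v)"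
    by (simp add: case_prod_unfold)
  then have "continuous_on S (\<lambda>x. integral (cbox 0 s) (f x))"
    by (rule integral_continuous_on_param)
  then show "continuous_on S (\<lambda>x. potential f x s)"
    using s by (simp add: potential_def)
qed


section \<open>The first variation of the energy\<close>

lemma continuous_nonneg_if_AE_nonneg:
  fixes g :: "'a::euclidean_space \<Rightarrow> real"
  assumes S: "open S" and g: "continuous_on S g" and AE: "AE x in lebesgue. x \<in> S \<longrightarrow> 0 \<le> g x"
    and x: "x \<in> S"
  shows "0 \<le> g x"
proof (rule ccontr)
  assume "\<not> 0 \<le> g x"
  then have ne: "{y \<in> S. g y < 0} \<noteq> {}" using x by auto
  have "open (S \<inter> g -` {..<0})"
    using continuous_open_preimage[OF g S open_lessThan] .
  moreover have "S \<inter> g -` {..<0} = {y \<in> S. g y < 0}" by auto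
  ultimately have "\<not> negligible {y \<in> S. g y < 0}"
    using open_not_negligible[of "{y \<in> S. g y < 0}"] ne by simp
  moreover obtain N where N: "{y \<in> space lebesgue. \<not> (y \<in> S \<longrightarrow> 0 \<le> g y)} \<subseteq> N" "N \<in> null_sets lebesgue"
    using AE_E[OF AE] by (force simp: null_sets_def)
  then have "negligible N" by (simp add: negligible_iff_null_sets)
  then have "negligible {y \<in> S. g y < 0}"
    by (rule negligible_subset) (use N(1) in force)
  ultimately show False by blast
qed

lemma bdry_notin_square: "0 \<le> t \<Longrightarrow> t \<le> 4 * a \<Longrightarrow> bdry a t \<notin> square a"
  by (auto simp: bdry_def square_def)

lemma gradient_add_cmult:
  assumes "v differentiable (at x)" "w differentiable (at x)"
  shows "gradient (\<lambda>y. v y + t * w y) x = gradient v x + t *\<^sub>R gradient w x"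
proof -
  have "partial b (\<lambda>y. v y + t * w y) x = partial b v x + t * partial b w x" for b
    using assms by (simp add: partial_add partial_cmult)
  then show ?thesis
    unfolding gradient_def by (simp add: scaleR_left_distrib sum.distrib scaleR_sum_right)
qed

text \<open>The approximating sequence is shifted by the same test function, which leaves all three
  differences unchanged: pointwise, almost everywhere, and on the boundary, where \<open>\<psi>\<close> vanishes.\<close>

lemma has_trace_add_test_function:
  assumes tr: "has_trace a u \<phi>" and \<psi>: "test_function (square a) \<psi>"
  shows "has_trace a (\<lambda>x. u x + t * \<psi> x) \<phi>"
proof -
  let ?S = "square a"
  note \<psi>' = test_functionD[OF \<psi>]
  obtain w where u: "u \<in> W12 ?S" and \<phi>: "L2_on {0..4 * a} (\<lambda>t. \<phi> (bdry a t))"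
    and w: "\<forall>n. smooth (w n :: real \<times> real \<Rightarrow> real)"
    and w1: "(\<lambda>n. LINT x:?S|lebesgue. (w n x - u x)\<^sup>2) \<longlonglongrightarrow> 0"
    and w2: "(\<lambda>n. LINT x:?S|lebesgue. (norm (gradient (w n) x - weak_gradient ?S u x))\<^sup>2) \<longlonglongrightarrow> 0"
    and w3: "(\<lambda>n. LINT t:{0..4 * a}|lebesgue. (w n (bdry a t) - \<phi> (bdry a t))\<^sup>2) \<longlonglongrightarrow> 0"
    using tr unfolding has_trace_def by blast
  define w' where "w' n x = w n x + t * \<psi> x" for n x
  have sm: "smooth (w' n)" for n
    unfolding w'_def[abs_def] using w \<psi>'(1) by (intro smooth_add smooth_mult smooth_const) auto
  have e1: "(LINT x:?S|lebesgue. (w' n x - (u x + t * \<psi> x))\<^sup>2) = (LINT x:?S|lebesgue. (w n x - u x)\<^sup>2)" for n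
    by (simp add: w'_def)
  have e2: "(LINT x:?S|lebesgue. (norm (gradient (w' n) x - weak_gradient ?S (\<lambda>x. u x + t * \<psi> x) x))\<^sup>2) =
      (LINT x:?S|lebesgue. (norm (gradient (w n) x - weak_gradient ?S u x))\<^sup>2)" for n
  proof (rule set_lebesgue_integral_AE_cong_complete(2))
    have g: "gradient (w' n) x = gradient (w n) x + t *\<^sub>R gradient \<psi> x" for x
      unfolding w'_def[abs_def] using w \<psi>'(1) by (intro gradient_add_cmult smooth_differentiable) auto
    show "AE x in lebesgue. x \<in> ?S \<longrightarrow>
      (norm (gradient (w' n) x - weak_gradient ?S (\<lambda>x. u x + t * \<psi> x) x))\<^sup>2 =
      (norm (gradient (w n) x - weak_gradient ?S u x))\<^sup>2"
      using W12_add_test_function(2)[OF open_square u \<psi>, of t]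
      by eventually_elim (simp add: g)
  qed
  have "\<psi> (bdry a s) = 0" if "s \<in> {0..4 * a}" for s
    using that bdry_notin_square[of s a] \<psi>'(3) not_in_supp[of "bdry a s" \<psi>] by auto
  then have e3: "(LINT s:{0..4 * a}|lebesgue. (w' n (bdry a s) - \<phi> (bdry a s))\<^sup>2) =
      (LINT s:{0..4 * a}|lebesgue. (w n (bdry a s) - \<phi> (bdry a s))\<^sup>2)" for n
    by (intro set_lebesgue_integral_cong) (auto simp: w'_def)
  show ?thesis
    unfolding has_trace_def
    using W12_add_test_function(1)[OF open_square u \<psi>, of t] \<phi> sm w1 w2 w3
    unfolding e1[symmetric] e2[symmetric] e3[symmetric] by blast
qed

lemma admissible_class_variation:
  assumes u: "u \<in> admissible_class a m \<phi>" and \<psi>: "test_function (square a) \<psi>"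
    and l: "l \<in> {1..m}"
    and nonneg: "\<And>x. x \<in> square a \<Longrightarrow> 0 \<le> u l x + t * \<psi> x"
    and seg: "\<And>x p. x \<in> square a \<Longrightarrow> p \<in> {1..m} \<Longrightarrow> p \<noteq> l \<Longrightarrow> \<psi> x * u p x = 0"
  shows "u(l := \<lambda>x. u l x + t * \<psi> x) \<in> admissible_class a m \<phi>"
proof -
  let ?S = "square a"
  let ?w = "u(l := \<lambda>x. u l x + t * \<psi> x)"
  note u' = u[unfolded admissible_class_def mem_Collect_eq]
  have "?w i \<in> W12 ?S \<and> (AE x in lebesgue. x \<in> ?S \<longrightarrow> 0 \<le> ?w i x) \<and> has_trace a (?w i) (\<phi> i) \<and>
      (\<forall>x\<in>frontier ?S. ?w i x = \<phi> i x)" if i: "i \<in> {1..m}" for i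
  proof (cases "i = l")
    case True
    have "\<psi> x = 0" if "x \<in> frontier ?S" for x
      using that open_square[of a] test_functionD(3)[OF \<psi>] not_in_supp[of x \<psi>]
      by (auto simp: frontier_def interior_open)
    then show ?thesis
      using True u' l W12_add_test_function(1)[OF open_square _ \<psi>] has_trace_add_test_function[OF _ \<psi>] nonneg
      by simp
  next
    case False
    then show ?thesis using u' i by simp
  qed
  moreover have "AE x in lebesgue. x \<in> ?S \<longrightarrow> ?w i x * ?w j x = 0"
    if ij: "i \<in> {1..m}" "j \<in> {1..m}" "i \<noteq> j" for i j
  proof -
    have "AE x in lebesgue. x \<in> ?S \<longrightarrow> u i x * u j x = 0" using u' ij by blast
    then show ?thesis
    proof eventually_elim
      case (elim x)
      show ?case
        using elim seg[of x i] seg[of x j] ij by (auto simp: algebra_simps)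
    qed
  qed
  ultimately show ?thesis unfolding admissible_class_def by blast
qed


lemma set_integrable_square_const: "set_integrable lebesgue (square a) (\<lambda>_. c :: real)"
proof (rule set_integrable_subset)
  show "set_integrable lebesgue (cbox (0, 0) (a, a)) (\<lambda>_. c)"
    by (intro set_integrable_compact) auto
  show "square a \<subseteq> cbox (0, 0) (a, a)"
    by (auto simp: square_def)
qed (use open_square in auto)

text \<open>Integrability of the energy density has to be established, since the energy of a
  non-integrable density is zero by convention and minimality would then say nothing.\<close>

lemma potential_set_integrable:
  assumes f: "regular_dynamics (square a) B L f" and u: "continuous_on (square a) u"
    "\<And>x. x \<in> square a \<Longrightarrow> 0 \<le> u x" and L2: "L2_on (square a) u"
  shows "set_integrable lebesgue (square a) (\<lambda>x. potential f x (u x))"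
proof (rule set_integrable_bound)
  have u2: "set_integrable lebesgue (square a) (\<lambda>x. (u x)\<^sup>2)"
    using L2 unfolding L2_on_def by simp
  show "set_integrable lebesgue (square a) (\<lambda>x. B + (B + L) * (u x)\<^sup>2)"
    by (intro set_integral_add set_integrable_mult_right set_integrable_square_const u2)
  show "set_borel_measurable lebesgue (square a) (\<lambda>x. potential f x (u x))"
    by (intro set_borel_measurable_continuous open_square continuous_on_potential[OF f u])
  have "\<bar>potential f x (u x)\<bar> \<le> \<bar>B + (B + L) * (u x)\<^sup>2\<bar>" if x: "x \<in> square a" for x
  proof -
    have "\<bar>potential f x (u x)\<bar> \<le> B * u x + L * (u x)\<^sup>2"
      using potential_bounds[OF f x u(2)[OF x]] by (simp add: algebra_simps power2_eq_square)
    also have "\<dots> \<le> B * (1 + (u x)\<^sup>2) + L * (u x)\<^sup>2"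
    proof -
      have "0 \<le> (u x - 1)\<^sup>2 + (u x)\<^sup>2 + 1" by simp
      then have "u x \<le> 1 + (u x)\<^sup>2" by (simp add: power2_eq_square algebra_simps)
      then show ?thesis using regular_dynamicsD(1)[OF f] by (simp add: mult_left_mono)
    qed
    also have "\<dots> = B + (B + L) * (u x)\<^sup>2" by (simp add: algebra_simps)
    finally show ?thesis by linarith
  qed
  then show "AE x in lebesgue. x \<in> square a \<longrightarrow> norm (potential f x (u x)) \<le> norm (B + (B + L) * (u x)\<^sup>2)"
    by simp
qed

lemma set_integrable_sum_and_integral:
  fixes g :: "'i \<Rightarrow> 'a \<Rightarrow> real"
  assumes "finite I" "\<And>i. i \<in> I \<Longrightarrow> set_integrable M S (g i)"
  shows "set_integrable M S (\<lambda>x. \<Sum>i\<in>I. g i x)"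
    and "(LINT x:S|M. \<Sum>i\<in>I. g i x) = (\<Sum>i\<in>I. LINT x:S|M. g i x)"
proof -
  have "set_integrable M S (\<lambda>x. \<Sum>i\<in>I. g i x) \<and>
    (LINT x:S|M. \<Sum>i\<in>I. g i x) = (\<Sum>i\<in>I. LINT x:S|M. g i x)"
    using assms
  proof (induction I)
    case empty
    then show ?case by (simp add: set_integrable_def set_lebesgue_integral_def)
  next
    case (insert j I)
    then show ?case
      using set_integral_add[of M S "g j" "\<lambda>x. \<Sum>i\<in>I. g i x"] by simp
  qed
  then show "set_integrable M S (\<lambda>x. \<Sum>i\<in>I. g i x)"
    "(LINT x:S|M. \<Sum>i\<in>I. g i x) = (\<Sum>i\<in>I. LINT x:S|M. g i x)" by auto
qed

definition energy_density ::
    "real \<Rightarrow> (real \<times> real \<Rightarrow> real \<Rightarrow> real) \<Rightarrow> (real \<times> real \<Rightarrow> real) \<Rightarrow> real \<times> real \<Rightarrow> real" where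
  "energy_density a f u x = 1 / 2 * (norm (weak_gradient (square a) u x))\<^sup>2 + potential f x (u x)"

lemma energy_density_integrable:
  assumes f: "regular_dynamics (square a) B L f" and u: "continuous_on (square a) u"
    "\<And>x. x \<in> square a \<Longrightarrow> 0 \<le> u x" and W: "u \<in> W12 (square a)"
  shows "set_integrable lebesgue (square a) (energy_density a f u)"
proof -
  have "L2_on (square a) u" using W unfolding W12_def by blast
  then have "set_integrable lebesgue (square a) (\<lambda>x. potential f x (u x))"
    by (intro potential_set_integrable[OF f u(1)] u(2))
  moreover have "set_integrable lebesgue (square a) (\<lambda>x. 1 / 2 * (norm (weak_gradient (square a) u x))\<^sup>2)"
    using W12_weak_gradient_L2[OF open_square W] unfolding L2_on_def
    by (intro set_integrable_mult_right) simp
  ultimately show ?thesis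
    unfolding energy_density_def[abs_def] by (intro set_integral_add)
qed

lemma potential_variation_le:
  assumes f: "regular_dynamics S B L f" and x: "x \<in> S" and s: "0 \<le> s" and r: "0 \<le> s + r"
  shows "potential f x (s + r) - potential f x s \<le> r * f x s + L * r\<^sup>2"
proof -
  have "potential f x (s + r) - potential f x s \<le> r * f x (s + r)"
    using potential_diff_le[OF f x s r] by simp
  also have "\<dots> = r * f x s + r * (f x (s + r) - f x s)" by (simp add: algebra_simps)
  also have "r * (f x (s + r) - f x s) \<le> \<bar>r\<bar> * \<bar>f x (s + r) - f x s\<bar>"
    by (metis abs_ge_self abs_mult)
  also have "\<dots> \<le> \<bar>r\<bar> * (L * \<bar>r\<bar>)"
    using regular_dynamicsD(5)[OF f x r s] by (intro mult_left_mono) auto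
  also have "\<dots> = L * r\<^sup>2" by (simp add: power2_eq_square mult.left_commute)
  finally show ?thesis by simp
qed

lemma linear_coefficient_eq_0:
  fixes p q \<delta> :: real
  assumes \<delta>: "0 < \<delta>" and *: "\<And>t. \<bar>t\<bar> \<le> \<delta> \<Longrightarrow> 0 \<le> t * p + t\<^sup>2 * q"
  shows "p = 0"
proof (rule ccontr)
  assume p: "p \<noteq> 0"
  \<comment> \<open>At \<open>t = - sgn p * r\<close> the linear term is \<open>- r * \<bar>p\<bar>\<close>, and \<open>r\<close> is small enough for it to dominate.\<close>
  define r where "r = min \<delta> (\<bar>p\<bar> / (2 * (\<bar>q\<bar> + 1)))"
  have r0: "0 < r" using p \<delta> by (simp add: r_def add_nonneg_pos)
  have r: "r \<le> \<delta>" unfolding r_def by (rule min.cobounded1)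
  have "r * (2 * (\<bar>q\<bar> + 1)) \<le> \<bar>p\<bar>"
  proof -
    have "r \<le> \<bar>p\<bar> / (2 * (\<bar>q\<bar> + 1))" unfolding r_def by (rule min.cobounded2)
    then show ?thesis by (simp add: pos_le_divide_eq add_nonneg_pos)
  qed
  then have rq: "r * \<bar>q\<bar> < \<bar>p\<bar>" 
  proof -
    have "r * (2 * (\<bar>q\<bar> + 1)) = 2 * (r * \<bar>q\<bar>) + 2 * r" by (simp add: algebra_simps)
    moreover have "0 \<le> r * \<bar>q\<bar>" using r0 by simp
    ultimately show ?thesis using r0 \<open>r * (2 * (\<bar>q\<bar> + 1)) \<le> \<bar>p\<bar>\<close> by linarith
  qed
  have "0 \<le> (- sgn p * r) * p + (- sgn p * r)\<^sup>2 * q"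
    using r r0 p by (intro *) (simp add: abs_mult abs_sgn_eq)
  also have "\<dots> = r * (- \<bar>p\<bar> + r * q)"
    using p by (simp add: sgn_if power2_eq_square algebra_simps)
  also have "\<dots> \<le> r * (- \<bar>p\<bar> + r * \<bar>q\<bar>)"
    using r0 by (intro mult_left_mono add_left_mono) auto
  also have "\<dots> < 0" using r0 rq by (simp add: mult_pos_neg)
  finally show False by simp
qed

lemma green_first_identity:
  fixes v :: "real \<times> real \<Rightarrow> real"
  assumes S: "open S" and v: "Ck 2 S v" and \<psi>: "test_function S \<psi>"
  shows "(LINT x:S|lebesgue. gradient v x \<bullet> gradient \<psi> x) = - (LINT x:S|lebesgue. laplacian v x * \<psi> x)"
proof -
  note \<psi>' = test_functionD[OF \<psi>]
  have C1: "Ck 1 S (partial b v)" if "b \<in> Basis" for b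
    using v that by (simp add: numeral_2_eq_2)
  have c0: "continuous_on S (partial b v)" if "b \<in> Basis" for b
    using Ck_SucD[of 0 S "partial b v"] C1[OF that] by simp
  have i1: "set_integrable lebesgue S (\<lambda>x. partial b v x * partial b \<psi> x)" if b: "b \<in> Basis" for b
    by (rule set_integrable_supported[OF _ \<psi>'(2,3)])
      (auto simp: partial_eq_0_off_supp
        intro!: continuous_on_mult c0 b smooth_continuous_on[OF smooth_partial[OF \<psi>'(1)]])
  have i2: "set_integrable lebesgue S (\<lambda>x. partial b (partial b v) x * \<psi> x)" if b: "b \<in> Basis" for b
    by (rule set_integrable_supported[OF _ \<psi>'(2,3)])
      (use C1[OF b] b in \<open>auto simp: not_in_supp
        intro!: continuous_on_mult smooth_continuous_on[OF \<psi>'(1)]\<close>)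
  have "gradient v x \<bullet> gradient \<psi> x = (\<Sum>b\<in>Basis. partial b v x * partial b \<psi> x)" for x
    by (subst euclidean_inner) (rule sum.cong; simp add: gradient_inner)
  then have "(LINT x:S|lebesgue. gradient v x \<bullet> gradient \<psi> x) =
      (LINT x:S|lebesgue. \<Sum>b\<in>Basis. partial b v x * partial b \<psi> x)"
    by (simp only:)
  also have "\<dots> = (\<Sum>b\<in>Basis. LINT x:S|lebesgue. partial b v x * partial b \<psi> x)"
    by (rule set_integrable_sum_and_integral) (auto intro: i1)
  also have "\<dots> = (\<Sum>b\<in>Basis. - (LINT x:S|lebesgue. partial b (partial b v) x * \<psi> x))"
  proof (rule sum.cong[OF refl])
    fix b :: "real \<times> real" assume b: "b \<in> Basis"
    show "(LINT x:S|lebesgue. partial b v x * partial b \<psi> x) = - (LINT x:S|lebesgue. partial b (partial b v) x * \<psi> x)"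
      using C1[OF b] b by (intro integration_by_parts[OF S _ b _ \<psi>]) auto
  qed
  also have "\<dots> = - (LINT x:S|lebesgue. \<Sum>b\<in>Basis. partial b (partial b v) x * \<psi> x)"
    using set_integrable_sum_and_integral(2)[of "Basis :: (real \<times> real) set" lebesgue S
        "\<lambda>b x. partial b (partial b v) x * \<psi> x"] i2
    by (simp add: sum_negf)
  finally show ?thesis by (simp only: laplacian_def sum_distrib_right)
qed

lemma continuous_on_laplacian:
  assumes "Ck 2 S v"
  shows "continuous_on S (laplacian v)"
  using assms unfolding laplacian_def[abs_def]
  by (intro continuous_on_sum) (simp add: numeral_2_eq_2)

text \<open>By the bound \<open>\<delta> \<bar>\<psi>\<bar> \<le> u\<^sub>l\<close> the perturbed component stays nonnegative for \<open>\<bar>t\<bar> \<le> \<delta>\<close> and \<open>\<psi>\<close> vanishes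
  wherever another component is positive, so the perturbed family is admissible. With \<open>A\<close> the
  formal derivative of the
  energy density, convexity of the potential and the Lipschitz bound give
  \<open>0 \<le> t \<integral>A + t\<^sup>2 \<integral>Q\<close> for both signs of \<open>t\<close>, which forces \<open>\<integral>A = 0\<close> without a limit under the
  integral sign.\<close>

lemma first_variation:
  assumes min: "energy_minimizer a m f \<phi> u"
    and reg: "\<And>i. i \<in> {1..m} \<Longrightarrow> \<exists>B L. regular_dynamics (square a) B L (f i)"
    and C2: "\<And>i. i \<in> {1..m} \<Longrightarrow> Ck 2 (square a) (u i)"
    and seg: "segregated_on (square a) m u" and l: "l \<in> {1..m}"
    and \<psi>: "test_function (square a) \<psi>" and \<delta>: "0 < \<delta>" "\<And>x. x \<in> square a \<Longrightarrow> \<delta> * \<bar>\<psi> x\<bar> \<le> u l x"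
  shows "(LINT x:square a|lebesgue. (f l x (u l x) - laplacian (u l) x) * \<psi> x) = 0"
proof -
  let ?S = "square a"
  note \<psi>' = test_functionD[OF \<psi>]
  have ad: "u \<in> admissible_class a m \<phi>"
    and le: "\<And>w. w \<in> admissible_class a m \<phi> \<Longrightarrow> energy a m f u \<le> energy a m f w"
    using min unfolding energy_minimizer_def by auto
  have W: "u i \<in> W12 ?S" if "i \<in> {1..m}" for i
    using ad that unfolding admissible_class_def by blast
  have C1: "Ck 1 ?S (u i)" if "i \<in> {1..m}" for i
    using C2[OF that] Ck_SucD[of 1 ?S "u i"] by (simp add: numeral_2_eq_2)
  have cont: "continuous_on ?S (u i)" if "i \<in> {1..m}" for i
    using C1[OF that] Ck_SucD[of 0 ?S "u i"] by simp
  have nonneg: "0 \<le> u i x" if "i \<in> {1..m}" "x \<in> ?S" for i x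
    using seg that unfolding segregated_on_def by blast
  obtain B L where f: "regular_dynamics ?S B L (f l)" using reg[OF l] by blast
  define A where "A x = gradient (u l) x \<bullet> gradient \<psi> x + f l x (u l x) * \<psi> x" for x
  define Q where "Q x = 1 / 2 * (norm (gradient \<psi> x))\<^sup>2 + L * (\<psi> x)\<^sup>2" for x
  have cg: "continuous_on ?S (gradient (u l))" "continuous_on ?S (gradient \<psi>)" "continuous_on ?S \<psi>"
    using continuous_on_gradient[OF C1[OF l]] continuous_on_gradient[OF test_function_C1[OF \<psi>]]
      smooth_continuous_on[OF \<psi>'(1)] by auto
  have cf: "continuous_on ?S (\<lambda>x. f l x (u l x))"
    by (rule continuous_on_dynamics[OF f cont[OF l] nonneg[OF l]])
  have iG: "set_integrable lebesgue ?S (\<lambda>x. gradient (u l) x \<bullet> gradient \<psi> x)"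
    by (rule set_integrable_supported[OF _ \<psi>'(2,3)])
      (auto simp: gradient_eq_0_off_supp intro!: continuous_on_inner cg)
  have iF: "set_integrable lebesgue ?S (\<lambda>x. f l x (u l x) * \<psi> x)"
    by (rule set_integrable_supported[OF _ \<psi>'(2,3)])
      (auto simp: not_in_supp intro!: continuous_on_mult cg cf)
  have iL: "set_integrable lebesgue ?S (\<lambda>x. laplacian (u l) x * \<psi> x)"
    by (rule set_integrable_supported[OF _ \<psi>'(2,3)])
      (auto simp: not_in_supp intro!: continuous_on_mult cg continuous_on_laplacian C2 l)
  have iA: "set_integrable lebesgue ?S A"
    unfolding A_def[abs_def] by (intro set_integral_add iG iF)
  have iQ: "set_integrable lebesgue ?S Q"
    by (rule set_integrable_supported[OF _ \<psi>'(2,3)])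
      (auto simp: Q_def[abs_def] not_in_supp gradient_eq_0_off_supp intro!: continuous_intros cg)
  have "0 \<le> t * (LINT x:?S|lebesgue. A x) + t\<^sup>2 * (LINT x:?S|lebesgue. Q x)" if t: "\<bar>t\<bar> \<le> \<delta>" for t
  proof -
    have small: "\<bar>t * \<psi> x\<bar> \<le> u l x" if "x \<in> ?S" for x
    proof -
      have "\<bar>t * \<psi> x\<bar> \<le> \<delta> * \<bar>\<psi> x\<bar>" using t by (simp add: abs_mult mult_right_mono)
      then show ?thesis using \<delta>(2)[OF that] by linarith
    qed
    define w where "w = u(l := \<lambda>x. u l x + t * \<psi> x)"
    have wl: "w l = (\<lambda>x. u l x + t * \<psi> x)" and wi: "\<And>i. i \<noteq> l \<Longrightarrow> w i = u i" by (auto simp: w_def)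
    have nonneg_l: "0 \<le> u l x + t * \<psi> x" if "x \<in> ?S" for x
      using small[OF that] by linarith
    have w: "w \<in> admissible_class a m \<phi>"
      unfolding w_def
    proof (rule admissible_class_variation[OF ad \<psi> l nonneg_l])
      fix x p assume x: "x \<in> ?S" and p: "p \<in> {1..m}" "p \<noteq> l"
      have "u l x = 0 \<or> u p x = 0"
        using seg x p l unfolding segregated_on_def by blast
      moreover have "\<psi> x = 0" if "u l x = 0"
        using \<delta>(2)[OF x] \<delta>(1) that by (simp add: mult_le_0_iff)
      ultimately show "\<psi> x * u p x = 0" by auto
    qed
    have ed: "energy a m f v = (LINT x:?S|lebesgue. \<Sum>i=1..m. energy_density a (f i) (v i) x)" for v
      unfolding energy_def energy_density_def ..
    have iu: "set_integrable lebesgue ?S (energy_density a (f i) (u i))" if i: "i \<in> {1..m}" for i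
      using reg[OF i] energy_density_integrable[OF _ cont[OF i] nonneg[OF i] W[OF i]] by blast
    have iw: "set_integrable lebesgue ?S (energy_density a (f i) (w i))" if i: "i \<in> {1..m}" for i
    proof (cases "i = l")
      case True
      have "set_integrable lebesgue ?S (energy_density a (f l) (\<lambda>x. u l x + t * \<psi> x))"
        by (rule energy_density_integrable[OF f _ nonneg_l W12_add_test_function(1)[OF open_square W[OF l] \<psi>]])
          (intro continuous_intros cont[OF l] cg)
      then show ?thesis using True wl by simp
    next
      case False
      then show ?thesis using iu[OF i] wi by simp
    qed
    have isum: "set_integrable lebesgue ?S (\<lambda>x. \<Sum>i=1..m. energy_density a (f i) (u i) x)"
      "set_integrable lebesgue ?S (\<lambda>x. \<Sum>i=1..m. energy_density a (f i) (w i) x)"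
      by (intro set_integrable_sum_and_integral; simp add: iu iw)+
    have itq: "set_integrable lebesgue ?S (\<lambda>x. t * A x + t\<^sup>2 * Q x)"
      by (intro set_integral_add set_integrable_mult_right iA iQ)
    have pw: "AE x in lebesgue. x \<in> ?S \<longrightarrow>
      (\<Sum>i=1..m. energy_density a (f i) (w i) x)
        \<le> (\<Sum>i=1..m. energy_density a (f i) (u i) x) + (t * A x + t\<^sup>2 * Q x)"
      using W12_add_test_function(2)[OF open_square W[OF l] \<psi>, of t]
        weak_gradient_AE_eq[OF open_square has_weak_gradient_C1[OF open_square C1[OF l]]]
    proof eventually_elim
      case (elim x)
      show ?case
      proof
        assume x: "x \<in> ?S"
        let ?g = "gradient (u l) x" and ?p = "gradient \<psi> x"
        have n: "(norm (?g + t *\<^sub>R ?p))\<^sup>2 = (norm ?g)\<^sup>2 + 2 * t * (?g \<bullet> ?p) + t\<^sup>2 * (norm ?p)\<^sup>2"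
          unfolding power2_norm_eq_inner
          by (simp add: inner_add_left inner_add_right inner_commute[of ?p ?g] power2_eq_square distrib_left)
        have F: "potential (f l) x (u l x + t * \<psi> x) - potential (f l) x (u l x)
            \<le> t * \<psi> x * f l x (u l x) + L * (t * \<psi> x)\<^sup>2"
          by (rule potential_variation_le[OF f x nonneg[OF l x] nonneg_l[OF x]])
        have "energy_density a (f l) (w l) x \<le> energy_density a (f l) (u l) x + (t * A x + t\<^sup>2 * Q x)"
          using elim x n F unfolding energy_density_def wl A_def Q_def
          by (simp add: algebra_simps power_mult_distrib)
        moreover have "(\<Sum>i\<in>{1..m} - {l}. energy_density a (f i) (w i) x) =
            (\<Sum>i\<in>{1..m} - {l}. energy_density a (f i) (u i) x)"
          by (intro sum.cong) (auto simp: wi)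
        moreover have sum_l: "(\<Sum>i=1..m. energy_density a (f i) (v i) x) =
            energy_density a (f l) (v l) x + (\<Sum>i\<in>{1..m} - {l}. energy_density a (f i) (v i) x)" for v
          using l by (intro sum.remove) auto
        ultimately show "(\<Sum>i=1..m. energy_density a (f i) (w i) x)
            \<le> (\<Sum>i=1..m. energy_density a (f i) (u i) x) + (t * A x + t\<^sup>2 * Q x)"
          unfolding sum_l by linarith
      qed
    qed
    have "energy a m f u \<le> energy a m f w" by (rule le[OF w])
    also have "\<dots> \<le> (LINT x:?S|lebesgue. (\<Sum>i=1..m. energy_density a (f i) (u i) x) + (t * A x + t\<^sup>2 * Q x))"
      unfolding ed by (intro set_integral_mono_AE isum set_integral_add itq pw)
    also have "\<dots> = energy a m f u + (LINT x:?S|lebesgue. t * A x + t\<^sup>2 * Q x)"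
      unfolding ed by (intro set_integral_add isum itq)
    also have "(LINT x:?S|lebesgue. t * A x + t\<^sup>2 * Q x) =
        (LINT x:?S|lebesgue. t * A x) + (LINT x:?S|lebesgue. t\<^sup>2 * Q x)"
      by (intro set_integral_add set_integrable_mult_right iA iQ)
    finally show ?thesis by simp
  qed
  then have "(LINT x:?S|lebesgue. A x) = 0"
    by (rule linear_coefficient_eq_0[OF \<delta>(1)])
  moreover have "(LINT x:?S|lebesgue. A x) =
      (LINT x:?S|lebesgue. gradient (u l) x \<bullet> gradient \<psi> x) + (LINT x:?S|lebesgue. f l x (u l x) * \<psi> x)"
    unfolding A_def by (intro set_integral_add iG iF)
  moreover have "(LINT x:?S|lebesgue. (f l x (u l x) - laplacian (u l) x) * \<psi> x) =
      (LINT x:?S|lebesgue. f l x (u l x) * \<psi> x) - (LINT x:?S|lebesgue. laplacian (u l) x * \<psi> x)"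
    using set_integral_diff(2)[OF iF iL] by (simp only: left_diff_distrib)
  ultimately show ?thesis
    using green_first_identity[OF open_square C2[OF l] \<psi>] by simp
qed


section \<open>The Euler--Lagrange equation\<close>

text \<open>If the two sides differed at \<open>z\<close>, a bump in a small box around \<open>z\<close>, on which the difference keeps its
  sign and \<open>u\<^sub>l\<close> stays above half of its value at \<open>z\<close>, would contradict the vanishing first
  variation.\<close>

lemma euler_lagrange:
  assumes min: "energy_minimizer a m f \<phi> u"
    and reg: "\<And>i. i \<in> {1..m} \<Longrightarrow> \<exists>B L. regular_dynamics (square a) B L (f i)"
    and C2: "\<And>i. i \<in> {1..m} \<Longrightarrow> Ck 2 (square a) (u i)"
    and seg: "segregated_on (square a) m u" and l: "l \<in> {1..m}"
    and z: "z \<in> square a" and pos: "0 < u l z"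
  shows "laplacian (u l) z = f l z (u l z)"
proof (rule ccontr)
  assume ne: "laplacian (u l) z \<noteq> f l z (u l z)"
  let ?S = "square a"
  obtain B L where f: "regular_dynamics ?S B L (f l)" using reg[OF l] by blast
  have nonneg: "0 \<le> u l x" if "x \<in> ?S" for x
    using seg l that unfolding segregated_on_def by blast
  have cont: "continuous_on ?S (u l)"
    using C2[OF l] Ck_SucD[of 1 ?S "u l"] Ck_SucD[of 0 ?S "u l"] by (simp add: numeral_2_eq_2)
  \<comment> \<open>Multiplying by the value at \<open>z\<close> treats both signs of the difference at once.\<close>
  define r where "r x = (f l x (u l x) - laplacian (u l) x) * (f l z (u l z) - laplacian (u l) z)" for x
  have cr: "continuous_on ?S r"
    unfolding r_def[abs_def]
    by (intro continuous_intros continuous_on_laplacian C2[OF l] continuous_on_dynamics[OF f cont nonneg])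
  have rz: "0 < r z" 
    using ne not_sum_squares_lt_zero[of "f l z (u l z) - laplacian (u l) z" 0]
    by (auto simp: r_def zero_less_mult_iff)
  define T where "T = (?S \<inter> r -` {0<..}) \<inter> (?S \<inter> u l -` {u l z / 2<..})"
  have "open T"
    unfolding T_def
    by (intro open_Int continuous_open_preimage[OF cr] continuous_open_preimage[OF cont] open_square open_greaterThan)
  moreover have "z \<in> T" using z rz pos by (simp add: T_def)
  ultimately obtain p q where pq: "cbox p q \<subseteq> T" "z \<in> box p q"
    by (rule open_contains_cbox)
  define \<psi> where "\<psi> = bump 1 p q"
  have \<psi>: "test_function ?S \<psi>"
    unfolding \<psi>_def using pq(1) by (intro test_function_bump) (auto simp: T_def)
  note \<psi>' = test_functionD[OF \<psi>]
  have in_T: "x \<in> T" if "\<psi> x \<noteq> 0" for x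
    using that bump_eq_0[of 1 x p q] pq(1) box_subset_cbox[of p q] unfolding \<psi>_def by auto
  have \<psi>0: "0 \<le> \<psi> x" and \<psi>1: "\<psi> x \<le> 1" for x
    unfolding \<psi>_def by (rule bump_nonneg, rule bump_le_1)
  have "(LINT x:?S|lebesgue. (f l x (u l x) - laplacian (u l) x) * \<psi> x) = 0"
  proof (rule first_variation[OF min reg C2 seg l \<psi>])
    show "0 < u l z / 2" using pos by simp
    fix x assume x: "x \<in> ?S"
    show "u l z / 2 * \<bar>\<psi> x\<bar> \<le> u l x"
    proof (cases "\<psi> x = 0")
      case True
      then show ?thesis using nonneg[OF x] by simp
    next
      case False
      have "u l z / 2 * \<bar>\<psi> x\<bar> \<le> u l z / 2 * 1"
        using \<psi>0[of x] \<psi>1[of x] pos by (intro mult_left_mono) auto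
      then show ?thesis using in_T[OF False] by (simp add: T_def)
    qed
  qed
  then have "(LINT x:?S|lebesgue. (f l z (u l z) - laplacian (u l) z) * ((f l x (u l x) - laplacian (u l) x) * \<psi> x)) = 0"
    by (simp only: set_integral_mult_right mult_zero_right)
  then have 0: "(LINT x:?S|lebesgue. r x * \<psi> x) = 0"
    by (simp add: r_def mult_ac)
  have c: "continuous_on ?S (\<lambda>x. r x * \<psi> x)"
    by (intro continuous_intros cr smooth_continuous_on \<psi>'(1))
  have "set_integrable lebesgue ?S (\<lambda>x. r x * \<psi> x)"
    by (rule set_integrable_supported[OF c \<psi>'(2,3)]) (simp add: not_in_supp)
  moreover have "0 \<le> r x * \<psi> x" for x
    using in_T[of x] \<psi>0[of x] by (cases "\<psi> x = 0") (auto simp: T_def intro!: mult_nonneg_nonneg)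
  ultimately have "AE x in lebesgue. indicat_real ?S x *\<^sub>R (r x * \<psi> x) = 0"
    using 0 unfolding set_integrable_def set_lebesgue_integral_def
    by (subst (asm) integral_nonneg_eq_0_iff_AE) (auto simp: indicator_def)
  then have "AE x in lebesgue. x \<in> ?S \<longrightarrow> 0 \<le> - (r x * \<psi> x)"
    by eventually_elim (auto simp: indicator_def)
  then have "0 \<le> - (r z * \<psi> z)"
    by (rule continuous_nonneg_if_AE_nonneg[OF open_square continuous_on_minus[OF c] _ z])
  moreover have "0 < \<psi> z" unfolding \<psi>_def using pq(2) by (simp add: bump_pos_iff)
  ultimately show False using rz by (simp add: mult_le_0_iff)
qed

lemma laplacian_eq_0:
  fixes v :: "'a::euclidean_space \<Rightarrow> real"
  assumes T: "open T" "z \<in> T" "\<And>x. x \<in> T \<Longrightarrow> v x = 0"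
  shows "laplacian v z = 0"
proof -
  have 1: "partial b v x = 0" if "x \<in> T" for b x
    using partial_cong_open[OF T(1) that, of v "\<lambda>_. 0" b] T(3) by (simp add: partial_const)
  have "partial b (partial b v) z = 0" for b
    using partial_cong_open[OF T(1,2), of "partial b v" "\<lambda>_. 0" b] 1 by (simp add: partial_const)
  then show ?thesis unfolding laplacian_def by simp
qed

text \<open>Otherwise the first derivative along the line through \<open>z\<close>, being zero at \<open>z\<close>, would be negative
  shortly after it, and the function would fall below its minimum.\<close>

lemma second_partial_nonneg_at_min:
  fixes v :: "'a::euclidean_space \<Rightarrow> real"
  assumes S: "open S" and v: "Ck 2 S v" and z: "z \<in> S" and min: "\<And>x. x \<in> S \<Longrightarrow> v z \<le> v x"
    and b: "b \<in> Basis"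
  shows "0 \<le> partial b (partial b v) z"
proof (rule ccontr)
  assume neg: "\<not> 0 \<le> partial b (partial b v) z"
  have d: "v differentiable (at x)" "partial b v differentiable (at x)" if "x \<in> S" for x
    using v b that by (auto simp: numeral_2_eq_2)
  obtain e where e: "e > 0" "ball z e \<subseteq> S" using S z open_contains_ball by blast
  have inS: "z + t *\<^sub>R b \<in> S" if "\<bar>t\<bar> < e" for t
    using that e(2) b by (auto simp: dist_norm subset_iff)
  have D0: "((\<lambda>s. v (z + s *\<^sub>R b)) has_real_derivative partial b v (z + t *\<^sub>R b)) (at t)" if "\<bar>t\<bar> < e" for t
    by (rule has_real_derivative_along_line[OF d(1)[OF inS[OF that]]])
  have "((\<lambda>s. v (z + s *\<^sub>R b)) has_real_derivative partial b v z) (at 0)"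
    using D0[of 0] e(1) by simp
  then have p0: "partial b v z = 0"
    by (rule DERIV_local_min[OF _ e(1)]) (use min inS in auto)
  have "((\<lambda>s. partial b v (z + s *\<^sub>R b)) has_real_derivative partial b (partial b v) z) (at 0)"
    using has_real_derivative_along_line[of "partial b v" z 0 b] d(2)[OF z] by simp
  from DERIV_neg_dec_right[OF this] neg
  have "\<exists>c>0. \<forall>h>0. h < c \<longrightarrow> partial b v (z + h *\<^sub>R b) < 0"
    by (simp add: p0)
  then obtain c where c: "c > 0" "\<And>h. 0 < h \<Longrightarrow> h < c \<Longrightarrow> partial b v (z + h *\<^sub>R b) < 0"
    by blast
  define h where "h = min c e / 2"
  have h: "0 < h" "h < c" "h < e" using c(1) e(1) by (auto simp: h_def min_def)
  obtain s where s: "0 < s" "s < h" "v (z + h *\<^sub>R b) - v (z + 0 *\<^sub>R b) = (h - 0) * partial b v (z + s *\<^sub>R b)"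
    using MVT2[OF h(1), of "\<lambda>s. v (z + s *\<^sub>R b)" "\<lambda>t. partial b v (z + t *\<^sub>R b)"] D0 h by auto
  have "(h - 0) * partial b v (z + s *\<^sub>R b) < 0"
    using c(2)[of s] s h by (simp add: mult_pos_neg)
  moreover have "v z \<le> v (z + h *\<^sub>R b)" using min inS h by simp
  ultimately show False using s(3) by simp
qed

lemma laplacian_nonneg_at_min:
  assumes "open S" "Ck 2 S v" "z \<in> S" "\<And>x. x \<in> S \<Longrightarrow> v z \<le> v x"
  shows "0 \<le> laplacian v z"
  unfolding laplacian_def by (intro sum_nonneg second_partial_nonneg_at_min[OF assms])

text \<open>Where \<open>\<Delta>u\<^sub>l > f\<^sub>l(x, u\<^sub>l)\<close>, an open condition, the Euler--Lagrange equation excludes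
  \<open>u\<^sub>l > 0\<close>. So \<open>u\<^sub>l\<close> would vanish near \<open>z\<close>, hence \<open>\<Delta>u\<^sub>l = 0\<close> there, which is at most \<open>f\<^sub>l(z, 0)\<close>.\<close>

lemma laplacian_le_at_zero:
  assumes min: "energy_minimizer a m f \<phi> u"
    and reg: "\<And>i. i \<in> {1..m} \<Longrightarrow> \<exists>B L. regular_dynamics (square a) B L (f i)"
    and C2: "\<And>i. i \<in> {1..m} \<Longrightarrow> Ck 2 (square a) (u i)"
    and seg: "segregated_on (square a) m u" and l: "l \<in> {1..m}"
    and z: "z \<in> square a" and zero: "u l z = 0"
  shows "laplacian (u l) z \<le> f l z 0"
proof (rule ccontr)
  assume gt: "\<not> laplacian (u l) z \<le> f l z 0"
  let ?S = "square a"
  obtain B L where f: "regular_dynamics ?S B L (f l)" using reg[OF l] by blast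
  have nonneg: "0 \<le> u l x" if "x \<in> ?S" for x
    using seg l that unfolding segregated_on_def by blast
  have cont: "continuous_on ?S (u l)"
    using C2[OF l] Ck_SucD[of 1 ?S "u l"] Ck_SucD[of 0 ?S "u l"] by (simp add: numeral_2_eq_2)
  define r where "r x = laplacian (u l) x - f l x (u l x)" for x
  have "continuous_on ?S r"
    unfolding r_def[abs_def]
    by (intro continuous_intros continuous_on_laplacian C2[OF l] continuous_on_dynamics[OF f cont nonneg])
  then have "open (?S \<inter> r -` {0<..})"
    using open_square open_greaterThan by (rule continuous_open_preimage)
  moreover have "z \<in> ?S \<inter> r -` {0<..}" using z gt zero by (simp add: r_def)
  moreover have "u l x = 0" if "x \<in> ?S \<inter> r -` {0<..}" for x
  proof (rule ccontr)
    assume "u l x \<noteq> 0"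
    then have "0 < u l x" using nonneg[of x] that by auto
    then have "laplacian (u l) x = f l x (u l x)"
      using euler_lagrange[OF min reg C2 seg l, of x] that by blast
    then show False using that by (simp add: r_def)
  qed
  ultimately have "laplacian (u l) z = 0" by (rule laplacian_eq_0)
  then show False using gt regular_dynamicsD(3)[OF f z] by simp
qed


section \<open>The minimizer solves the scheme up to the consistency error\<close>

text \<open>The continuous counterpart of the inequalities of the scheme. Near a point with \<open>u\<^sub>l > 0\<close> the
  other components vanish identically; at any point their Laplacians are nonnegative, by the equation
  where they are positive and by minimality where they are zero.\<close>

lemma laplacian_gap_bounds:
  assumes min: "energy_minimizer a m f \<phi> u"
    and reg: "\<And>i. i \<in> {1..m} \<Longrightarrow> \<exists>B L. regular_dynamics (square a) B L (f i)"
    and C2: "\<And>i. i \<in> {1..m} \<Longrightarrow> Ck 2 (square a) (u i)"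
    and seg: "segregated_on (square a) m u" and l: "l \<in> {1..m}" and z: "z \<in> square a"
  defines "G \<equiv> laplacian (u l) z - (\<Sum>p\<in>{1..m} - {l}. laplacian (u p) z)"
  shows "G \<le> f l z (u l z)" and "0 < u l z \<Longrightarrow> G = f l z (u l z)"
proof -
  let ?S = "square a"
  have nonneg: "0 \<le> u i x" if "i \<in> {1..m}" "x \<in> ?S" for i x
    using seg that unfolding segregated_on_def by blast
  have cont: "continuous_on ?S (u i)" if "i \<in> {1..m}" for i
    using C2[OF that] Ck_SucD[of 1 ?S "u i"] Ck_SucD[of 0 ?S "u i"] by (simp add: numeral_2_eq_2)
  show pos: "G = f l z (u l z)" if "0 < u l z"
  proof -
    have "laplacian (u p) z = 0" if p: "p \<in> {1..m} - {l}" for p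
    proof (rule laplacian_eq_0)
      show "open (?S \<inter> u l -` {0<..})"
        by (rule continuous_open_preimage[OF cont[OF l] open_square open_greaterThan])
      show "z \<in> ?S \<inter> u l -` {0<..}" using z \<open>0 < u l z\<close> by simp
      fix x assume x: "x \<in> ?S \<inter> u l -` {0<..}"
      then have "u l x = 0 \<or> u p x = 0"
        using seg p l unfolding segregated_on_def by blast
      then show "u p x = 0" using x by auto
    qed
    then show ?thesis
      using euler_lagrange[OF min reg C2 seg l z that] unfolding G_def by simp
  qed
  show "G \<le> f l z (u l z)"
  proof (cases "0 < u l z")
    case True
    then show ?thesis using pos by simp
  next
    case False
    then have zero: "u l z = 0" using nonneg[OF l z] by linarith
    have "0 \<le> laplacian (u p) z" if p: "p \<in> {1..m}" for p
    proof (cases "0 < u p z")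
      case True
      obtain B L where f: "regular_dynamics ?S B L (f p)" using reg[OF p] by blast
      show ?thesis
        using euler_lagrange[OF min reg C2 seg p z True]
          regular_dynamics_bounds(1)[OF f z nonneg[OF p z]] by simp
    next
      case False
      then have "u p z = 0" using nonneg[OF p z] by linarith
      then show ?thesis
        using laplacian_nonneg_at_min[OF open_square C2[OF p] z] nonneg[OF p] by simp
    qed
    then have "0 \<le> (\<Sum>p\<in>{1..m} - {l}. laplacian (u p) z)"
      by (intro sum_nonneg) auto
    then show ?thesis
      using laplacian_le_at_zero[OF min reg C2 seg l z zero] zero unfolding G_def by simp
  qed
qed

lemma mesh_interior_subset_square:
  assumes "h = a / real N" "a > 0"
  shows "mesh_interior h N \<subseteq> square a"
proof
  fix z assume "z \<in> mesh_interior h N"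
  then obtain i j where ij: "z = (real i * h, real j * h)" "1 \<le> i" "i \<le> N - 1" "1 \<le> j" "j \<le> N - 1"
    unfolding mesh_interior_def by auto
  have N: "real N > 0" "a = real N * h" "h > 0" using ij assms by auto
  have "real i * h < real N * h" "real j * h < real N * h"
    using ij N(3) by (auto intro!: mult_strict_right_mono)
  then show "z \<in> square a" using ij N unfolding square_def by auto
qed

lemma mesh_boundary_subset_frontier:
  assumes "h = a / real N" "a > 0" "N \<ge> 1"
  shows "mesh_boundary h N \<subseteq> frontier (square a)"
proof
  fix z assume z: "z \<in> mesh_boundary h N"
  then obtain i j where ij: "z = (real i * h, real j * h)" "i \<le> N" "j \<le> N"
    unfolding mesh_boundary_def mesh_def by auto
  have N: "a = real N * h" "h > 0" using assms by auto
  have "\<not> (i \<in> {1..N - 1} \<and> j \<in> {1..N - 1})"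
    using z ij(1) unfolding mesh_boundary_def mesh_interior_def by blast
  then have edge: "i = 0 \<or> i = N \<or> j = 0 \<or> j = N" using ij by auto
  have "real i * h \<le> real N * h" "real j * h \<le> real N * h"
    using ij N(2) by (auto intro!: mult_right_mono)
  then have "z \<in> cbox (0, 0) (a, a)" using ij N by auto
  moreover have "z \<notin> square a" using edge ij N unfolding square_def by auto
  moreover have "closure (square a) = cbox (0, 0) (a, a)"
    unfolding square_def using assms(2) by (simp add: closure_Times cbox_Pair_eq)
  ultimately show "z \<in> frontier (square a)"
    using open_square by (simp add: frontier_def interior_open)
qed

text \<open>Sign and segregation, required almost everywhere, hold everywhere by continuity.\<close>

lemma minimizer_segregated:
  assumes u: "u \<in> admissible_class a m \<phi>" and C2: "\<And>i. i \<in> {1..m} \<Longrightarrow> Ck 2 (square a) (u i)"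
  shows "segregated_on (square a) m u"
  unfolding segregated_on_def
proof (intro conjI ballI impI)
  let ?S = "square a"
  note u' = u[unfolded admissible_class_def mem_Collect_eq]
  have cont: "continuous_on ?S (u i)" if "i \<in> {1..m}" for i
    using C2[OF that] Ck_SucD[of 1 ?S "u i"] Ck_SucD[of 0 ?S "u i"] by (simp add: numeral_2_eq_2)
  fix l z assume l: "l \<in> {1..m}" and z: "z \<in> ?S"
  show "0 \<le> u l z"
    using u' l by (intro continuous_nonneg_if_AE_nonneg[OF open_square cont[OF l] _ z]) blast
  fix p assume p: "p \<in> {1..m}" "l \<noteq> p"
  have "AE x in lebesgue. x \<in> ?S \<longrightarrow> u l x * u p x = 0" using u' l p by blast
  then have "AE x in lebesgue. x \<in> ?S \<longrightarrow> 0 \<le> - \<bar>u l x * u p x\<bar>"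
    by eventually_elim simp
  moreover have "continuous_on ?S (\<lambda>x. - \<bar>u l x * u p x\<bar>)"
    by (intro continuous_intros cont l p)
  ultimately have "0 \<le> - \<bar>u l z * u p z\<bar>"
    using continuous_nonneg_if_AE_nonneg[OF open_square _ _ z] by blast
  then show "u l z = 0 \<or> u p z = 0" by simp
qed

theorem minimizer_is_approx_discrete_solution:
  assumes min: "energy_minimizer a m f \<phi> u"
    and reg: "\<And>i. i \<in> {1..m} \<Longrightarrow> \<exists>B L. regular_dynamics (square a) B L (f i)"
    and C2: "\<And>i. i \<in> {1..m} \<Longrightarrow> Ck 2 (square a) (u i)"
    and h: "h = a / real N" and a: "a > 0" and N: "N \<ge> 1"
    and \<phi>: "segregated_on (mesh_boundary h N) m \<phi>"
    and \<epsilon>: "\<And>k z. k \<in> {1..m} \<Longrightarrow> z \<in> square a \<Longrightarrow>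
      \<bar>discrete_laplacian h (u k) z - laplacian (u k) z\<bar> \<le> \<epsilon> k"
  shows "approx_discrete_solution h N m f (\<Sum>k=1..m. \<epsilon> k) u"
proof -
  have ad: "u \<in> admissible_class a m \<phi>" using min unfolding energy_minimizer_def by blast
  have seg: "segregated_on (square a) m u" by (rule minimizer_segregated[OF ad C2])
  have bd: "u i z = \<phi> i z" if "i \<in> {1..m}" "z \<in> mesh_boundary h N" for i z
    using ad that mesh_boundary_subset_frontier[OF h a N] unfolding admissible_class_def by blast
  have split: "z \<in> square a \<or> z \<in> mesh_boundary h N" if "z \<in> mesh h N" for z
    using that mesh_interior_subset_square[OF h a] unfolding mesh_boundary_def by blast
  have "segregated_on (mesh h N) m u"
    unfolding segregated_on_def
  proof (intro conjI ballI impI)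
    fix l z assume l: "l \<in> {1..m}" and z: "z \<in> mesh h N"
    show "0 \<le> u l z"
      using split[OF z] seg \<phi> bd[OF l] l unfolding segregated_on_def by metis
    fix p assume "p \<in> {1..m}" "l \<noteq> p"
    then show "u l z = 0 \<or> u p z = 0"
      using split[OF z] seg \<phi> bd l unfolding segregated_on_def by metis
  qed
  moreover have "\<bar>discrete_laplacian h (component_gap m u l) z -
      (laplacian (u l) z - (\<Sum>p\<in>{1..m} - {l}. laplacian (u p) z))\<bar> \<le> (\<Sum>k=1..m. \<epsilon> k)"
    if l: "l \<in> {1..m}" and z: "z \<in> square a" for l z
  proof -
    let ?e = "\<lambda>k. discrete_laplacian h (u k) z - laplacian (u k) z"
    have "discrete_laplacian h (component_gap m u l) z -
        (laplacian (u l) z - (\<Sum>p\<in>{1..m} - {l}. laplacian (u p) z)) = ?e l - (\<Sum>p\<in>{1..m} - {l}. ?e p)"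
      by (simp add: discrete_laplacian_component_gap sum_subtractf)
    also have "\<bar>\<dots>\<bar> \<le> \<bar>?e l\<bar> + (\<Sum>p\<in>{1..m} - {l}. \<bar>?e p\<bar>)"
      using sum_abs[of ?e "{1..m} - {l}"] by linarith
    also have "\<dots> = (\<Sum>k=1..m. \<bar>?e k\<bar>)"
      by (rule sum.remove[symmetric]) (use l in auto)
    also have "\<dots> \<le> (\<Sum>k=1..m. \<epsilon> k)"
      using \<epsilon> z by (intro sum_mono) auto
    finally show ?thesis .
  qed
  moreover note laplacian_gap_bounds[OF min reg C2 seg]
  ultimately show ?thesis
    unfolding approx_discrete_solution_def
    using mesh_interior_subset_square[OF h a] by (fastforce simp: abs_le_iff)
qed

lemma sup_norm_on_boundD:
  assumes "sup_norm_on S v \<noteq> top" "x \<in> S"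
  shows "\<bar>v x\<bar> \<le> enn2real (sup_norm_on S v)"
proof -
  have "ennreal \<bar>v x\<bar> \<le> sup_norm_on S v"
    unfolding sup_norm_on_def by (rule SUP_upper[OF assms(2)])
  then show ?thesis using assms(1)
    by (metis enn2real_ennreal enn2real_mono abs_ge_zero top.not_eq_extremum)
qed

theorem proposition1:
  fixes a :: real
  assumes "a > 0"
  shows "\<exists>C>0. \<forall>(m::nat) (N::nat) (h::real)
           (f :: nat \<Rightarrow> real \<times> real \<Rightarrow> real \<Rightarrow> real) (\<phi> :: nat \<Rightarrow> real \<times> real \<Rightarrow> real)
           (u :: nat \<Rightarrow> real \<times> real \<Rightarrow> real) (v :: nat \<Rightarrow> real \<times> real \<Rightarrow> real).
           m \<ge> 2 \<longrightarrow> N \<ge> 1 \<longrightarrow> h = a / real N \<longrightarrow>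
           admissible_dynamics a m f \<longrightarrow>
           admissible_boundary a m \<phi> \<longrightarrow>
           (\<forall>l\<in>{1..m}. \<forall>z\<in>square a. mono_on {0..} (f l z)) \<longrightarrow>
           energy_minimizer a m f \<phi> u \<longrightarrow>
           (\<forall>l\<in>{1..m}. Ck 2 (square a) (u l)) \<longrightarrow>
           discrete_solution h N m f \<phi> v \<longrightarrow>
           (\<forall>l\<in>{1..m}.
              ennreal (mesh_norm h N (\<lambda>z. u l z - v l z))
                \<le> ennreal C *
                  (\<Sum>k=1..m. sup_norm_on (square a)
                     (\<lambda>z. discrete_laplacian h (u k) z - laplacian (u k) z)))"
proof (rule exI[of _ "a\<^sup>2 / 8"], intro conjI allI impI ballI)
  show C: "0 < a\<^sup>2 / 8" using assms by simp
  fix m N :: nat and h :: real and f :: "nat \<Rightarrow> real \<times> real \<Rightarrow> real \<Rightarrow> real"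
    and \<phi> u v :: "nat \<Rightarrow> real \<times> real \<Rightarrow> real" and l
  assume N: "1 \<le> N" and h: "h = a / real N" and dyn: "admissible_dynamics a m f"
    and bd: "admissible_boundary a m \<phi>" and mono: "\<forall>l\<in>{1..m}. \<forall>z\<in>square a. mono_on {0..} (f l z)"
    and min: "energy_minimizer a m f \<phi> u" and C2: "\<forall>l\<in>{1..m}. Ck 2 (square a) (u l)"
    and v: "discrete_solution h N m f \<phi> v" and l: "l \<in> {1..m}"
  define E where "E k = sup_norm_on (square a) (\<lambda>z. discrete_laplacian h (u k) z - laplacian (u k) z)" for k
  show "ennreal (mesh_norm h N (\<lambda>z. u l z - v l z)) \<le> ennreal (a\<^sup>2 / 8) *
      (\<Sum>k=1..m. sup_norm_on (square a) (\<lambda>z. discrete_laplacian h (u k) z - laplacian (u k) z))"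
    unfolding E_def[symmetric]
  \<comment> \<open>An infinite consistency error makes the right-hand side infinite, as the constant is positive.\<close>
  proof (cases "\<exists>k\<in>{1..m}. E k = top")
    case True
    then obtain k where k: "k \<in> {1..m}" "E k = top" by blast
    then have "E k \<le> (\<Sum>k=1..m. E k)" by (intro member_le_sum) auto
    then have "(\<Sum>k=1..m. E k) = top" using k by (simp add: top_unique)
    moreover have "ennreal (a\<^sup>2 / 8) \<noteq> 0" using C by simp
    ultimately have "ennreal (a\<^sup>2 / 8) * (\<Sum>k=1..m. E k) = top"
      by (simp only: ennreal_mult_top if_False)
    then show "ennreal (mesh_norm h N (\<lambda>z. u l z - v l z)) \<le> ennreal (a\<^sup>2 / 8) * (\<Sum>k=1..m. E k)"
      by simp
  next
    case False
    define \<epsilon> where "\<epsilon> k = enn2real (E k)" for k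
    have reg: "\<exists>B L. regular_dynamics (square a) B L (f i)" if "i \<in> {1..m}" for i
      using admissible_dynamics_regular[OF dyn that] mono that by metis
    have seg\<phi>: "segregated_on (mesh_boundary h N) m \<phi>"
      using bd mesh_boundary_subset_frontier[OF h assms N]
      unfolding segregated_on_def admissible_boundary_def by (metis mult_eq_0_iff subsetD)
    have U: "approx_discrete_solution h N m f (\<Sum>k=1..m. \<epsilon> k) u"
    proof (rule minimizer_is_approx_discrete_solution[OF min reg _ h assms N seg\<phi>])
      fix k z assume "k \<in> {1..m}" "z \<in> square a"
      then show "\<bar>discrete_laplacian h (u k) z - laplacian (u k) z\<bar> \<le> \<epsilon> k"
        using False unfolding \<epsilon>_def E_def by (intro sup_norm_on_boundD) auto
    qed (use C2 in simp_all)
    have V: "approx_discrete_solution h N m f 0 v"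
    proof (rule discrete_solution_is_approx[OF v _ _ seg\<phi>])
      show "0 < h" using h assms N by simp
      fix i z and s :: real assume i: "i \<in> {1..m}" and z: "z \<in> mesh_interior h N" and s: "0 \<le> s"
      obtain B L where "regular_dynamics (square a) B L (f i)" using reg[OF i] by blast
      then show "0 \<le> f i z s"
        using regular_dynamics_bounds(1) mesh_interior_subset_square[OF h assms] z s by blast
    qed
    have \<epsilon>0: "0 \<le> (\<Sum>k=1..m. \<epsilon> k)" unfolding \<epsilon>_def by (intro sum_nonneg) simp
    have le: "\<bar>u l z - v l z\<bar> \<le> a\<^sup>2 / 8 * ((\<Sum>k=1..m. \<epsilon> k) + 0)" if z: "z \<in> mesh h N" for z
    proof (rule discrete_comparison[OF U V _ h assms N _ _ l z])
      show "0 \<le> (\<Sum>k=1..m. \<epsilon> k) + 0" using \<epsilon>0 by simp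
      show "mono_on {0..} (f i y)" if "i \<in> {1..m}" "y \<in> mesh_interior h N" for i y
        using mono that mesh_interior_subset_square[OF h assms] by blast
      fix i y assume i: "i \<in> {1..m}" and y: "y \<in> mesh_boundary h N"
      have "u i y = \<phi> i y"
        using min i y mesh_boundary_subset_frontier[OF h assms N]
        unfolding energy_minimizer_def admissible_class_def by blast
      moreover have "v i y = \<phi> i y"
        using v i y unfolding discrete_solution_def by blast
      ultimately show "u i y = v i y" by simp
    qed
    have fin: "finite (mesh h N)"
    proof -
      have "mesh h N = (\<lambda>(i, j). (real i * h, real j * h)) ` ({..N} \<times> {..N})"
        unfolding mesh_def by auto
      then show ?thesis by simp
    qed
    have ne: "mesh h N \<noteq> {}" unfolding mesh_def by blast
    have "mesh_norm h N (\<lambda>z. u l z - v l z) \<le> a\<^sup>2 / 8 * (\<Sum>k=1..m. \<epsilon> k)"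
      unfolding mesh_norm_def using fin ne le by (subst Max_le_iff) auto
    then have "ennreal (mesh_norm h N (\<lambda>z. u l z - v l z)) \<le> ennreal (a\<^sup>2 / 8 * (\<Sum>k=1..m. \<epsilon> k))"
      by (rule ennreal_leI)
    also have "\<dots> = ennreal (a\<^sup>2 / 8) * (\<Sum>k=1..m. ennreal (\<epsilon> k))"
    proof -
      have "(\<Sum>k=1..m. ennreal (\<epsilon> k)) = ennreal (\<Sum>k=1..m. \<epsilon> k)"
        by (intro sum_ennreal) (simp add: \<epsilon>_def)
      then show ?thesis by (simp only: ennreal_mult''[OF \<epsilon>0])
    qed
    also have "(\<Sum>k=1..m. ennreal (\<epsilon> k)) = (\<Sum>k=1..m. E k)"
      using False by (intro sum.cong) (auto simp: \<epsilon>_def less_top)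
    finally show "ennreal (mesh_norm h N (\<lambda>z. u l z - v l z)) \<le> ennreal (a\<^sup>2 / 8) * (\<Sum>k=1..m. E k)" .
  qed
qed

end
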